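(* Let $\mathbb V$ be a vertex operator algebra and $(\mathbb W,Y_{\mathbb W})$ an admissible $\mathbb V$-module. Then $(\mathbb W',Y_{\mathbb W'})$ is an admissible $\mathbb V$-module (called the contragredient module of $\mathbb W$). If $\mathbb W$ is finitely-admissible, then so is $\mathbb W'$, and under the canonical identification $\mathbb W=\mathbb W''$ we have $Y_{\mathbb W}=Y_{\mathbb W''}$.
   Context: All vector spaces are over $\mathbb C$; $\mathbb N=\{0,1,2,\dots\}$. A vertex operator algebra (VOA) is a vector space $\mathbb V=\bigoplus_{n\in\mathbb N}\mathbb V(n)$, graded by a diagonalizable operator $L_0$ with eigenvalues in $\mathbb N$ ($L_0|_{\mathbb V(n)}=n$), with a linear map $u\mapsto Y(u,z)=\sum_{n\in\mathbb Z}Y(u)_nz^{-n-1}\in\mathrm{End}(\mathbb V)[[z^{\pm1}]]$, a vacuum vector $\mathbf 1\in\mathbb V(0)$, operators $(L_n)_{n\in\mathbb Z}$ (including $L_0$) with $[L_m,L_n]=(m-n)L_{m+n}+\frac c{12}(m+1)m(m-1)\delta_{m,-n}$ for some $c\in\mathbb C$, and a conformal vector $\mathbf c\in\mathbb V$ with $Y(\mathbf c)_n=L_{n-1}$, such that: $Y(\mathbf 1,z)=\mathrm{id}$; $Y(v)_{-1}\mathbf 1=v$ and $Y(v)_n\mathbf 1=0$ for $n\ge0$; $[L_0,Y(v,z)]=Y(L_0v,z)+z\partial_zY(v,z)$; $L_{-1}\mathbf 1=0$ and $[L_{-1},Y(v,z)]=\partial_zY(v,z)$; and the Jacobi identity: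 for all $u,v\in\mathbb V$, $m,n,k\in\mathbb Z$, $$\sum_{l\ge0}\binom mlY(Y(u)_{n+l}v)_{m+k-l}=\sum_{l\ge0}(-1)^l\binom nlY(u)_{m+n-l}Y(v)_{k+l}-\sum_{l\ge0}(-1)^{n+l}\binom nlY(v)_{n+k-l}Y(u)_{m+l}.$$ A weak $\mathbb V$-module is a vector space $\mathbb W$ with a linear map $Y_{\mathbb W}:\mathbb V\to\mathrm{End}(\mathbb W)[[z^{\pm1}]]$, $Y_{\mathbb W}(v,z)=\sum_nY_{\mathbb W}(v)_nz^{-n-1}$, such that $Y_{\mathbb W}(v,z)w\in\mathbb W((z))$, $Y_{\mathbb W}(\mathbf 1,z)=\mathrm{id}_{\mathbb W}$, and the Jacobi identity above holds with $Y(Y(u)_{n+l}v)_{m+k-l}$, $Y(u)_\bullet$, $Y(v)_\bullet$ replaced by $Y_{\mathbb W}(Y(u)_{n+l}v)_{m+k-l}$, $Y_{\mathbb W}(u)_\bullet$, $Y_{\mathbb W}(v)_\bullet$. It is an admissible $\mathbb V$-module if moreover $\mathbb W=\bigoplus_{n\in\mathbb N}\mathbb W(n)$ is graded by a diagonalizable operator $\widetilde L_0$ ($\widetilde L_0|_{\mathbb W(n)}=n$) with $[\widetilde L_0,Y_{\mathbb W}(v,z)]=Y_{\mathbb W}(L_0v,z)+z\partial_zY_{\mathbb W}(v,z)$; finitely-admissible if moreover each $\mathbb W(n)$ is finite-dimensional. For an admissible $\mathbb W$, $\mathbb W'=\bigoplus_{n\in\mathbb N}\mathbb W(n)^*$ with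 $\widetilde L_0$ acting on $\mathbb W'(n)=\mathbb W(n)^*$ as $n$, and $Y_{\mathbb W'}:\mathbb V\to\mathrm{End}(\mathbb W')[[z^{\pm1}]]$ is defined by $$\langle Y_{\mathbb W'}(v,z)w',w\rangle=\big\langle w',Y_{\mathbb W}\big(e^{zL_1}(-z^{-2})^{L_0}v,z^{-1}\big)w\big\rangle\qquad(v\in\mathbb V,\,w\in\mathbb W,\,w'\in\mathbb W').$$ When $\mathbb W$ is finitely-admissible, $\mathbb W''=\bigoplus_n\mathbb W(n)^{**}=\mathbb W$ canonically. *)

theory Defs
  imports
    Complex_Main
    "HOL-Library.Function_Algebras"
    "HOL-Library.Groups_Big_Fun"
begin

text \<open>
  The algebra V is a whole type with a scalar multiplication; a module W is a subspace (the carrier)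
  of an ambient complex vector space, so that the graded dual, which is a set of functions, is again
  an instance of the same notion. Operators on W are functions on the ambient type, and only their
  values on W matter.

  \<^const>\<open>Sum_any\<close> is the sum of a finitely supported family (and 0 if the support is infinite).
\<close>

section \<open>Graded vector spaces\<close>

definition endo_on :: "(complex \<Rightarrow> 'a \<Rightarrow> 'a) \<Rightarrow> 'a set \<Rightarrow> ('a \<Rightarrow> 'a::ab_group_add) \<Rightarrow> bool" where
  "endo_on s W T \<longleftrightarrow>
     (\<forall>x\<in>W. T x \<in> W) \<and>
     (\<forall>x\<in>W. \<forall>y\<in>W. T (x + y) = T x + T y) \<and>
     (\<forall>a. \<forall>x\<in>W. T (s a x) = s a (T x))"

definition homog :: "(complex \<Rightarrow> 'a \<Rightarrow> 'a) \<Rightarrow> 'a set \<Rightarrow> ('a \<Rightarrow> 'a) \<Rightarrow> nat \<Rightarrow> 'a set" where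
  "homog s W T n = {w \<in> W. T w = s (of_nat n) w}"

definition decomposition :: "(nat \<Rightarrow> 'a::comm_monoid_add set) \<Rightarrow> 'a \<Rightarrow> (nat \<Rightarrow> 'a) \<Rightarrow> bool" where
  "decomposition G v x \<longleftrightarrow> (\<forall>n. x n \<in> G n) \<and> finite {n. x n \<noteq> 0} \<and> Sum_any x = v"

definition component :: "(nat \<Rightarrow> 'a::comm_monoid_add set) \<Rightarrow> 'a \<Rightarrow> nat \<Rightarrow> 'a" where
  "component G v = (THE x. decomposition G v x)"

text \<open>\<open>T\<close> is a diagonalizable operator with eigenvalues in the natural numbers, i.e.\ \<open>W\<close> is the
  direct sum of the eigenspaces \<open>homog s W T n\<close>.\<close>

definition grading_operator ::
    "(complex \<Rightarrow> 'a \<Rightarrow> 'a) \<Rightarrow> 'a set \<Rightarrow> ('a \<Rightarrow> 'a::ab_group_add) \<Rightarrow> bool" where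
  "grading_operator s W T \<longleftrightarrow>
     endo_on s W T \<and> (\<forall>w\<in>W. \<exists>!x. decomposition (homog s W T) w x)"

section \<open>Vertex operator algebras and modules\<close>

text \<open>\<open>Y v n\<close> is the mode of \<open>Y(v,z)\<close> at \<open>z\<close> to the power \<open>- n - 1\<close>.\<close>

definition jacobi_identity ::
    "('v \<Rightarrow> int \<Rightarrow> 'v \<Rightarrow> 'v) \<Rightarrow> (complex \<Rightarrow> 'w \<Rightarrow> 'w) \<Rightarrow> 'w set \<Rightarrow>
     ('v \<Rightarrow> int \<Rightarrow> 'w \<Rightarrow> 'w::ab_group_add) \<Rightarrow> bool" where
  "jacobi_identity Y sW W YW \<longleftrightarrow>
     (\<forall>u v. \<forall>m n k :: int. \<forall>w\<in>W.
        Sum_any (\<lambda>l::nat. sW (of_int m gchoose l) (YW (Y u (n + int l) v) (m + k - int l) w)) =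
        Sum_any (\<lambda>l::nat. sW ((-1) ^ l * (of_int n gchoose l))
                            (YW u (m + n - int l) (YW v (k + int l) w))) -
        Sum_any (\<lambda>l::nat. sW ((-1) powi (n + int l) * (of_int n gchoose l))
                            (YW v (n + k - int l) (YW u (m + int l) w))))"

text \<open>The lower truncation property of \<open>Y\<close>, which makes the sums in the Jacobi identity finite, is
  not an axiom of a vertex operator algebra: it follows from the grading by \<open>L 0\<close> and \<open>grading\<close>.\<close>

locale voa = vector_space sV
  for sV :: "complex \<Rightarrow> 'v::ab_group_add \<Rightarrow> 'v" +
  fixes Y :: "'v \<Rightarrow> int \<Rightarrow> 'v \<Rightarrow> 'v"
    and vac :: 'v
    and L :: "int \<Rightarrow> 'v \<Rightarrow> 'v"
    and conf :: 'v
  assumes L_endo: "endo_on sV UNIV (L n)"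
    and L0_grading: "grading_operator sV UNIV (L 0)"
    and Y_endo: "endo_on sV UNIV (Y v n)"
    and Y_add: "Y (u + v) n w = Y u n w + Y v n w"
    and Y_scale: "Y (sV a v) n w = sV a (Y v n w)"
    and vac_degree: "vac \<in> homog sV UNIV (L 0) 0"
    and virasoro: "\<exists>c::complex. \<forall>m n v.
          L m (L n v) - L n (L m v) =
          sV (of_int (m - n)) (L (m + n) v) +
          (if m = - n then sV (c / 12 * of_int ((m + 1) * m * (m - 1))) v else 0)"
    and conformal: "Y conf n = L (n - 1)"
    and Y_vac: "Y vac n w = (if n = -1 then w else 0)"
    and creation: "Y v (-1) vac = v" "n \<ge> 0 \<Longrightarrow> Y v n vac = 0"
    and grading: "L 0 (Y v n w) - Y v n (L 0 w) = Y (L 0 v) n w - sV (of_int (n + 1)) (Y v n w)"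
    and L_minus1_vac: "L (-1) vac = 0"
    and translation: "L (-1) (Y v n w) - Y v n (L (-1) w) = - sV (of_int n) (Y v (n - 1) w)"
    and jacobi: "jacobi_identity Y sV UNIV Y"

locale weak_module = voa sV Y vac L conf + W: vector_space sW
  for sV :: "complex \<Rightarrow> 'v::ab_group_add \<Rightarrow> 'v"
    and Y :: "'v \<Rightarrow> int \<Rightarrow> 'v \<Rightarrow> 'v"
    and vac :: 'v
    and L :: "int \<Rightarrow> 'v \<Rightarrow> 'v"
    and conf :: 'v
    and sW :: "complex \<Rightarrow> 'w::ab_group_add \<Rightarrow> 'w" +
  fixes W :: "'w set"
    and YW :: "'v \<Rightarrow> int \<Rightarrow> 'w \<Rightarrow> 'w"
  assumes W_subspace: "W.subspace W"
    and YW_endo: "endo_on sW W (YW v n)"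
    and YW_add: "w \<in> W \<Longrightarrow> YW (u + v) n w = YW u n w + YW v n w"
    and YW_scale: "w \<in> W \<Longrightarrow> YW (sV a v) n w = sW a (YW v n w)"
    and YW_truncation: "w \<in> W \<Longrightarrow> \<exists>N. \<forall>n\<ge>N. YW v n w = 0"
    and YW_vac: "w \<in> W \<Longrightarrow> YW vac n w = (if n = -1 then w else 0)"
    and YW_jacobi: "jacobi_identity Y sW W YW"

locale admissible_module = weak_module sV Y vac L conf sW W YW
  for sV :: "complex \<Rightarrow> 'v::ab_group_add \<Rightarrow> 'v"
    and Y :: "'v \<Rightarrow> int \<Rightarrow> 'v \<Rightarrow> 'v"
    and vac :: 'v
    and L :: "int \<Rightarrow> 'v \<Rightarrow> 'v"
    and conf :: 'v
    and sW :: "complex \<Rightarrow> 'w::ab_group_add \<Rightarrow> 'w"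
    and W :: "'w set"
    and YW :: "'v \<Rightarrow> int \<Rightarrow> 'w \<Rightarrow> 'w" +
  fixes LW :: "'w \<Rightarrow> 'w"
  assumes LW_grading: "grading_operator sW W LW"
    and YW_grading: "w \<in> W \<Longrightarrow>
          LW (YW v n w) - YW v n (LW w) = YW (L 0 v) n w - sW (of_int (n + 1)) (YW v n w)"

locale finitely_admissible_module = admissible_module +
  assumes finite_dim: "\<exists>B. finite B \<and> W.span B = homog sW W LW n"

section \<open>The contragredient module\<close>

definition scale_fun :: "complex \<Rightarrow> ('a \<Rightarrow> complex) \<Rightarrow> 'a \<Rightarrow> complex" where
  "scale_fun a f = (\<lambda>x. a * f x)"

text \<open>The dual of \<open>W(n)\<close>: a functional on \<open>W(n)\<close> is extended by 0 to the other summands of \<open>W\<close>, and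
  also to the complement of \<open>W\<close> in the ambient type, so that functionals that agree on \<open>W\<close> are equal.
  The pairing of the graded dual with \<open>W\<close> is then function application.\<close>

definition dual_homog ::
    "(complex \<Rightarrow> 'w \<Rightarrow> 'w) \<Rightarrow> 'w set \<Rightarrow> ('w \<Rightarrow> 'w) \<Rightarrow> nat \<Rightarrow> ('w::ab_group_add \<Rightarrow> complex) set" where
  "dual_homog sW W LW n =
     {f. (\<forall>x\<in>W. \<forall>y\<in>W. f (x + y) = f x + f y) \<and>
         (\<forall>a. \<forall>x\<in>W. f (sW a x) = a * f x) \<and>
         (\<forall>m. m \<noteq> n \<longrightarrow> (\<forall>x\<in>homog sW W LW m. f x = 0)) \<and>
         (\<forall>x. x \<notin> W \<longrightarrow> f x = 0)}"

definition graded_dual ::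
    "(complex \<Rightarrow> 'w \<Rightarrow> 'w) \<Rightarrow> 'w set \<Rightarrow> ('w \<Rightarrow> 'w) \<Rightarrow> ('w::ab_group_add \<Rightarrow> complex) set" where
  "graded_dual sW W LW = {f. \<exists>x. decomposition (dual_homog sW W LW) f x}"

definition dual_L0 ::
    "(complex \<Rightarrow> 'w \<Rightarrow> 'w) \<Rightarrow> 'w set \<Rightarrow> ('w \<Rightarrow> 'w) \<Rightarrow>
     ('w::ab_group_add \<Rightarrow> complex) \<Rightarrow> 'w \<Rightarrow> complex" where
  "dual_L0 sW W LW f =
     Sum_any (\<lambda>n. scale_fun (of_nat n) (component (dual_homog sW W LW) f n))"

text \<open>Formal series in \<open>z\<close> with coefficients in V are functions from the integers, the value at \<open>k\<close>
  being the coefficient of \<open>z\<close> to the power \<open>k\<close>. The next three functions are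
  \<open>exp (z T) v\<close>, \<open>(- z powi (-2)) powr T v\<close> (which is \<open>(-1) ^ d * z powi (- 2 * d)\<close> times \<open>v\<close> if \<open>v\<close>
  is homogeneous of degree \<open>d\<close>), and \<open>exp (z L\<^sub>1) ((- z powi (-2)) powr L\<^sub>0 v)\<close>.\<close>

definition exp_z :: "(complex \<Rightarrow> 'v \<Rightarrow> 'v) \<Rightarrow> ('v \<Rightarrow> 'v) \<Rightarrow> 'v \<Rightarrow> int \<Rightarrow> 'v::ab_group_add" where
  "exp_z s T v k = (if k \<ge> 0 then s (1 / fact (nat k)) ((T ^^ nat k) v) else 0)"

definition minus_z_inv_sq_pow ::
    "(complex \<Rightarrow> 'v \<Rightarrow> 'v) \<Rightarrow> ('v \<Rightarrow> 'v) \<Rightarrow> 'v \<Rightarrow> int \<Rightarrow> 'v::ab_group_add" where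
  "minus_z_inv_sq_pow s T v k =
     Sum_any (\<lambda>d::nat. if k = - 2 * int d then s ((-1) ^ d) (component (homog s UNIV T) v d) else 0)"

definition contragredient_vector ::
    "(complex \<Rightarrow> 'v \<Rightarrow> 'v) \<Rightarrow> (int \<Rightarrow> 'v \<Rightarrow> 'v) \<Rightarrow> 'v \<Rightarrow> int \<Rightarrow> 'v::ab_group_add" where
  "contragredient_vector s L v k =
     Sum_any (\<lambda>j::int. exp_z s (L 1) (minus_z_inv_sq_pow s (L 0) v j) (k - j))"

text \<open>If \<open>A\<close> is a Laurent polynomial in \<open>z\<close> with coefficients \<open>A k\<close> in V, then \<open>Y\<^sub>W(A(z), 1/z)\<close> is the
  sum of \<open>Y\<^sub>W(A k)\<^sub>n z powi (k + n + 1)\<close> over \<open>k\<close> and \<open>n\<close>; its coefficient at \<open>z powi (- m - 1)\<close>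
  therefore collects the terms with \<open>n = - m - 2 - k\<close>.\<close>

definition contragredient ::
    "(complex \<Rightarrow> 'v \<Rightarrow> 'v) \<Rightarrow> (int \<Rightarrow> 'v \<Rightarrow> 'v) \<Rightarrow> 'w set \<Rightarrow> ('v \<Rightarrow> int \<Rightarrow> 'w \<Rightarrow> 'w) \<Rightarrow>
     'v::ab_group_add \<Rightarrow> int \<Rightarrow> ('w::ab_group_add \<Rightarrow> complex) \<Rightarrow> 'w \<Rightarrow> complex" where
  "contragredient sV L W YW v m f =
     (\<lambda>w. if w \<in> W
          then Sum_any (\<lambda>k::int. f (YW (contragredient_vector sV L v k) (- m - 2 - k) w))
          else 0)"

text \<open>The canonical map from \<open>W\<close> to its double dual, where \<open>W'\<close> is the graded dual of \<open>W\<close>.\<close>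

definition eval_at :: "('w \<Rightarrow> complex) set \<Rightarrow> 'w \<Rightarrow> ('w \<Rightarrow> complex) \<Rightarrow> complex" where
  "eval_at W' w = (\<lambda>f. if f \<in> W' then f w else 0)"

end

theory Submission
  imports Defs "HOL-Computational_Algebra.Formal_Power_Series"
begin

text \<open>
  Everything is transported through the pairing of the graded dual with \<open>W\<close>: the mode
  \<open>Y'(v)\<^sub>m\<close> sends a form \<open>f\<close> to \<open>f \<circ> \<theta>(v)\<^sub>m\<close>, where the operator
  \<open>\<theta>(v)\<^sub>m\<close> on \<open>W\<close> is called \<open>adj v m\<close> below. If \<open>v\<close> has degree \<open>d\<close>, then
  \<open>\<theta>(v)\<^sub>m\<close> is the sum over \<open>i\<close> of \<open>(-1)\<^sup>d / i!\<close> times the mode of \<open>L\<^sub>1\<^sup>i v\<close> with index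
  \<open>2d - m - 2 - i\<close> (\<open>adj_homog\<close>), and it shifts the degree of a homogeneous vector of \<open>W\<close> by
  \<open>m + 1 - d\<close>. This shift gives the grading and the truncation property of the contragredient
  module.

  The Jacobi identity of the contragredient module says that the operators \<open>\<theta>\<close> satisfy the Jacobi
  identity with their products in the opposite order (\<open>adj_Jacobi\<close>). For \<open>u\<close> of degree \<open>d\<close> and
  \<open>v\<close> of degree \<open>e\<close>, the products of \<open>\<theta>\<close>s with exponents \<open>m, n, k\<close> are combinations of
  products of modes of \<open>L\<^sub>1\<^sup>i u\<close> and \<open>L\<^sub>1\<^sup>j v\<close>. These are exactly the products in the Jacobi identity
  of \<open>W\<close> with exponents \<open>2d - 2 - i - m - n\<close>, \<open>n\<close>, \<open>2e - 2 - j - k - n\<close>; this is the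
  substitution of \<open>1/z\<close> for \<open>z\<close>, under which \<open>z - x\<close> becomes \<open>(x - z)/(z x)\<close>. So they reduce to
  modes of the vectors \<open>(L\<^sub>1\<^sup>i u)\<^sub>n\<^sub>+\<^sub>t L\<^sub>1\<^sup>j v\<close>. The other side of the identity consists of modes of
  \<open>L\<^sub>1\<^sup>s (u\<^sub>n\<^sub>+\<^sub>l v)\<close>, which expand into the same vectors by iterating the commutator of \<open>L\<^sub>1\<close> with a
  mode (\<open>L1_pow_mode\<close>). The coefficients agree by the Vandermonde identity
  (\<open>alternating_Vandermonde\<close>). Bilinearity extends the result to all \<open>u\<close> and \<open>v\<close>.

  For the double dual, applying the passage from modes to adjoint modes twice gives the modes back
  (\<open>adj_involution\<close>), because alternating sums of binomial coefficients vanish. The linear algebra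
  of the identification of \<open>W\<close> with its double dual is done in each degree with a basis and its
  dual basis.
\<close>

section \<open>Finitely supported sums\<close>

text \<open>
  Operators and forms on \<open>W\<close> are only controlled on the carrier, so that additivity is relative
  to a set.
\<close>

definition additive_on :: "'a set \<Rightarrow> ('a::ab_group_add \<Rightarrow> 'b::ab_group_add) \<Rightarrow> bool" where
  "additive_on W h \<longleftrightarrow> (\<forall>x\<in>W. \<forall>y\<in>W. h (x + y) = h x + h y)"

lemma additive_onD: "additive_on W h \<Longrightarrow> x \<in> W \<Longrightarrow> y \<in> W \<Longrightarrow> h (x + y) = h x + h y"
  by (auto simp: additive_on_def)

lemma additive_on_zero: "additive_on W h \<Longrightarrow> 0 \<in> W \<Longrightarrow> h 0 = 0"
  using additive_onD[of W h 0 0] by simp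

lemma additive_on_sum:
  assumes "additive_on W h" "0 \<in> W" "\<And>x y. x \<in> W \<Longrightarrow> y \<in> W \<Longrightarrow> x + y \<in> W"
    and "\<And>i. i \<in> A \<Longrightarrow> g i \<in> W"
  shows "h (\<Sum>i\<in>A. g i) = (\<Sum>i\<in>A. h (g i))"
proof (cases "finite A")
  case True
  then have "(\<Sum>i\<in>A. g i) \<in> W \<and> h (\<Sum>i\<in>A. g i) = (\<Sum>i\<in>A. h (g i))"
    using assms(4)
    by (induction A) (use assms(1-3) in \<open>auto simp: additive_on_zero additive_onD\<close>)
  then show ?thesis by simp
qed (use assms in \<open>simp add: additive_on_zero\<close>)

lemma Sum_any_eq_sum: "finite A \<Longrightarrow> (\<And>x. x \<notin> A \<Longrightarrow> g x = 0) \<Longrightarrow> Sum_any g = sum g A"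
  by (rule Sum_any.expand_superset) auto

lemma additive_on_Sum_any:
  assumes "additive_on W h" "0 \<in> W" "\<And>x y. x \<in> W \<Longrightarrow> y \<in> W \<Longrightarrow> x + y \<in> W"
    and "\<And>i. g i \<in> W" and "finite {i. g i \<noteq> 0}"
  shows "h (Sum_any g) = Sum_any (\<lambda>i. h (g i))"
proof -
  have "Sum_any g = sum g {i. g i \<noteq> 0}"
    by (rule Sum_any_eq_sum) (use assms in auto)
  moreover have "Sum_any (\<lambda>i. h (g i)) = (\<Sum>i\<in>{i. g i \<noteq> 0}. h (g i))"
    by (rule Sum_any_eq_sum) (use assms additive_on_zero[OF assms(1,2)] in auto)
  ultimately show ?thesis
    using additive_on_sum[OF assms(1-3), of "{i. g i \<noteq> 0}" g] assms(4) by simp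
qed

lemma Sum_any_apply:
  assumes "finite {i. g i \<noteq> 0}"
  shows "(Sum_any g :: 'a \<Rightarrow> complex) x = Sum_any (\<lambda>i. g i x)"
  by (rule additive_on_Sum_any[where W = UNIV and h = "\<lambda>f. f x"])
    (use assms in \<open>simp_all add: additive_on_def\<close>)

text \<open>
  Each inner family must have finite support: the sum of a family with infinite support is 0 by
  convention, and such a default value would spoil the exchange.
\<close>

lemma Sum_any_sum_swap:
  assumes "\<And>a. a \<in> A \<Longrightarrow> finite {l. g a l \<noteq> 0}"
  shows "Sum_any (\<lambda>l. \<Sum>a\<in>A. g a l) = (\<Sum>a\<in>A. Sum_any (g a))"
proof (cases "finite A")
  case True
  then show ?thesis using assms
  proof (induction A)
    case empty then show ?case by simp
  next
    case (insert x F)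
    have "finite (\<Union>a\<in>F. {l. g a l \<noteq> 0})" using insert by auto
    moreover have "{l. (\<Sum>a\<in>F. g a l) \<noteq> 0} \<subseteq> (\<Union>a\<in>F. {l. g a l \<noteq> 0})"
      using sum.neutral by force
    ultimately have "finite {l. (\<Sum>a\<in>F. g a l) \<noteq> 0}" by (rule finite_subset[rotated])
    then have "Sum_any (\<lambda>l. g x l + (\<Sum>a\<in>F. g a l)) = Sum_any (g x) + Sum_any (\<lambda>l. \<Sum>a\<in>F. g a l)"
      using insert.prems by (intro Sum_any.distrib) auto
    then show ?case using insert by simp
  qed
qed simp

lemma Sum_any_sum_swap2:
  assumes "\<And>i j. i \<in> A \<Longrightarrow> j \<in> B \<Longrightarrow> finite {l. g i j l \<noteq> 0}"
  shows "Sum_any (\<lambda>l. \<Sum>i\<in>A. \<Sum>j\<in>B. g i j l) = (\<Sum>i\<in>A. \<Sum>j\<in>B. Sum_any (g i j))"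
proof -
  have "Sum_any (\<lambda>l. \<Sum>p\<in>A \<times> B. g (fst p) (snd p) l) = (\<Sum>p\<in>A \<times> B. Sum_any (g (fst p) (snd p)))"
    by (rule Sum_any_sum_swap) (use assms in auto)
  then show ?thesis by (simp add: sum.cartesian_product case_prod_beta)
qed

lemma finite_nat_support: "(\<And>l. l \<ge> (N::nat) \<Longrightarrow> g l = 0) \<Longrightarrow> finite {l. g l \<noteq> 0}"
  by (rule finite_subset[of _ "{..<N}"]) (auto simp: not_le[symmetric])

lemma Sum_any_eq_sum_lessThan: "(\<And>l. l \<ge> (N::nat) \<Longrightarrow> g l = 0) \<Longrightarrow> Sum_any g = sum g {..<N}"
  by (rule Sum_any_eq_sum) auto

lemma (in vector_space) Sum_any_scale: "Sum_any (\<lambda>l. scale c (g l)) = scale c (Sum_any g)"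
proof (cases "c = 0")
  case False
  then have "{l. scale c (g l) \<noteq> 0} = {l. g l \<noteq> 0}" by auto
  then show ?thesis by (simp add: Sum_any.expand_set scale_sum_right)
qed simp

lemma (in vector_space) finite_support_scale:
  "finite {l. g l \<noteq> 0} \<Longrightarrow> finite {l. scale (c l) (g l) \<noteq> 0}"
  by (rule finite_subset[of _ "{l. g l \<noteq> 0}"]) auto

lemma (in vector_space) Sum_any_in_subspace:
  "subspace S \<Longrightarrow> (\<And>i. g i \<in> S) \<Longrightarrow> Sum_any g \<in> S"
  by (simp add: Sum_any.expand_set subspace_sum)

section \<open>Binomial identities and sums over triples\<close>

definition triples :: "nat \<Rightarrow> (nat \<times> nat \<times> nat) set" where
  "triples s = {(i, j, q). i + j + q = s}"

lemma finite_triples: "finite (triples s)"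
  by (rule finite_subset[of _ "{..s} \<times> {..s} \<times> {..s}"]) (auto simp: triples_def)

text \<open>
  Raising one of the three indices turns a sum over triples of total \<open>s\<close> into a sum over triples of
  total \<open>s + 1\<close>; the new triples in which that index is 0 must contribute nothing.
\<close>

lemma
  fixes F :: "nat \<Rightarrow> nat \<Rightarrow> nat \<Rightarrow> 'a::comm_monoid_add"
  shows sum_triples_shift1: "(\<And>j q. F 0 j q = 0) \<Longrightarrow>
      (\<Sum>(i, j, q)\<in>triples s. F (Suc i) j q) = (\<Sum>(i, j, q)\<in>triples (Suc s). F i j q)"
    and sum_triples_shift2: "(\<And>i q. F i 0 q = 0) \<Longrightarrow>
      (\<Sum>(i, j, q)\<in>triples s. F i (Suc j) q) = (\<Sum>(i, j, q)\<in>triples (Suc s). F i j q)"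
    and sum_triples_shift3: "(\<And>i j. F i j 0 = 0) \<Longrightarrow>
      (\<Sum>(i, j, q)\<in>triples s. F i j (Suc q)) = (\<Sum>(i, j, q)\<in>triples (Suc s). F i j q)"
proof -
  assume F: "\<And>j q. F 0 j q = 0"
  have "(\<Sum>(i, j, q)\<in>triples (Suc s). F i j q) =
      (\<Sum>(i, j, q)\<in>{(i, j, q)\<in>triples (Suc s). i \<noteq> 0}. F i j q)"
    by (rule sum.mono_neutral_right) (auto simp: finite_triples F intro!: gr0I)
  also have "\<dots> = (\<Sum>(i, j, q)\<in>triples s. F (Suc i) j q)"
    by (rule sum.reindex_bij_witness[where j = "\<lambda>(i, j, q). (i - 1, j, q)" and i = "\<lambda>(i, j, q). (Suc i, j, q)"])
      (auto simp: triples_def)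
  finally show "(\<Sum>(i, j, q)\<in>triples s. F (Suc i) j q) = (\<Sum>(i, j, q)\<in>triples (Suc s). F i j q)" ..
next
  assume F: "\<And>i q. F i 0 q = 0"
  have "(\<Sum>(i, j, q)\<in>triples (Suc s). F i j q) =
      (\<Sum>(i, j, q)\<in>{(i, j, q)\<in>triples (Suc s). j \<noteq> 0}. F i j q)"
    by (rule sum.mono_neutral_right) (auto simp: finite_triples F intro!: gr0I)
  also have "\<dots> = (\<Sum>(i, j, q)\<in>triples s. F i (Suc j) q)"
    by (rule sum.reindex_bij_witness[where j = "\<lambda>(i, j, q). (i, j - 1, q)" and i = "\<lambda>(i, j, q). (i, Suc j, q)"])
      (auto simp: triples_def)
  finally show "(\<Sum>(i, j, q)\<in>triples s. F i (Suc j) q) = (\<Sum>(i, j, q)\<in>triples (Suc s). F i j q)" ..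
next
  assume F: "\<And>i j. F i j 0 = 0"
  have "(\<Sum>(i, j, q)\<in>triples (Suc s). F i j q) =
      (\<Sum>(i, j, q)\<in>{(i, j, q)\<in>triples (Suc s). q \<noteq> 0}. F i j q)"
    by (rule sum.mono_neutral_right) (auto simp: finite_triples F intro!: gr0I)
  also have "\<dots> = (\<Sum>(i, j, q)\<in>triples s. F i j (Suc q))"
    by (rule sum.reindex_bij_witness[where j = "\<lambda>(i, j, q). (i, j, q - 1)" and i = "\<lambda>(i, j, q). (i, j, Suc q)"])
      (auto simp: triples_def)
  finally show "(\<Sum>(i, j, q)\<in>triples s. F i j (Suc q)) = (\<Sum>(i, j, q)\<in>triples (Suc s). F i j q)" ..
qed

text \<open>
  The recurrence for the coefficients that arise when \<open>L\<^sub>1\<close> is applied once more in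
  \<open>L1_pow_mode\<close>.
\<close>

lemma gbinomial_recurrence:
  fixes x :: complex
  shows "of_nat i * ((x + 1) gchoose q) + (if q = 0 then 0 else (x - of_nat i - of_nat (q - 1)) * (x gchoose (q - 1)))
    = (of_nat i + of_nat q) * (x gchoose q)"
proof (cases q)
  case (Suc p)
  have "x * (x gchoose p) = of_nat p * (x gchoose p) + of_nat (Suc p) * (x gchoose Suc p)"
    by (rule gbinomial_mult_1)
  moreover have "(x + 1) gchoose Suc p = (x gchoose p) + (x gchoose Suc p)"
    by (rule gbinomial_Suc_Suc)
  ultimately show ?thesis unfolding Suc by (simp only: diff_Suc_1 nat.simps if_False) (simp add: algebra_simps)
qed simp

text \<open>
  Negating the upper index turns \<open>((A - l) gchoose (t - l))\<close> into
  \<open>(-1) ^ (t - l) * ((t - A - 1) gchoose (t - l))\<close>, whose upper index no longer depends on \<open>l\<close>; what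
  is left is the Vandermonde convolution, and negating the upper index once more gives the result.
\<close>

lemma alternating_Vandermonde:
  fixes A a :: complex
  shows "(\<Sum>l\<le>t. (-1) ^ l * (a gchoose l) * ((A - of_nat l) gchoose (t - l))) = (A - a) gchoose t"
proof -
  have "(-1) ^ l * (a gchoose l) * ((A - of_nat l) gchoose (t - l)) =
      (-1) ^ t * ((a gchoose l) * ((of_nat t - A - 1) gchoose (t - l)))" if "l \<in> {..t}" for l
  proof -
    have upper: "(A - of_nat l) gchoose (t - l) =
        (-1) ^ (t - l) * ((of_nat (t - l) - (A - of_nat l) - 1) gchoose (t - l))"
      by (rule gbinomial_negated_upper)
    have arg: "of_nat (t - l) - (A - of_nat l) - 1 = of_nat t - A - 1"
      using that by (simp add: of_nat_diff)
    have sign: "(-1) ^ t = ((-1) ^ l * (-1) ^ (t - l) :: complex)"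
      using that by (simp flip: power_add)
    show ?thesis unfolding upper arg sign by (simp only: mult_ac)
  qed
  then have "(\<Sum>l\<le>t. (-1) ^ l * (a gchoose l) * ((A - of_nat l) gchoose (t - l))) =
      (-1) ^ t * (\<Sum>l = 0..t. (a gchoose l) * ((of_nat t - A - 1) gchoose (t - l)))"
    unfolding sum_distrib_left atLeast0AtMost by (rule sum.cong[OF refl])
  also have "\<dots> = (-1) ^ t * ((of_nat t - (A - a) - 1) gchoose t)"
    unfolding gbinomial_Vandermonde by (simp add: algebra_simps)
  also have "\<dots> = (A - a) gchoose t" by (rule gbinomial_negated_upper[symmetric])
  finally show ?thesis .
qed

lemma sum_triangle:
  fixes f :: "nat \<Rightarrow> nat \<Rightarrow> 'a::comm_monoid_add"
  shows "(\<Sum>l<N. \<Sum>q<N - l. f l q) = (\<Sum>t<N. \<Sum>l\<le>t. f l (t - l))"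
proof -
  have "(\<Sum>l<N. \<Sum>q<N - l. f l q) = (\<Sum>(l, q)\<in>(SIGMA l:{..<N}. {..<N - l}). f l q)"
    by (rule sum.Sigma) auto
  also have "(SIGMA l:{..<N}. {..<N - l}) = {(l, q). l + q < N}" by auto
  finally show ?thesis unfolding sum.triangle_reindex .
qed

text \<open>
  A family that vanishes outside a box can be summed either by total degree or over the box, as
  soon as the range of the total degree covers the box.
\<close>

lemma sum_triples_atMost:
  fixes f :: "nat \<Rightarrow> nat \<Rightarrow> nat \<Rightarrow> 'a::comm_monoid_add"
  assumes "A + B + C \<le> R"
    and "\<And>i j q. i > A \<or> j > B \<or> q \<ge> C \<Longrightarrow> f i j q = 0"
  shows "(\<Sum>s\<le>R. \<Sum>(i, j, q)\<in>triples s. f i j q) = (\<Sum>i\<le>A. \<Sum>j\<le>B. \<Sum>q<C. f i j q)"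
proof -
  have "(\<Sum>s\<le>R. \<Sum>(i, j, q)\<in>triples s. f i j q) = (\<Sum>(i, j, q)\<in>(\<Union>s\<in>{..R}. triples s). f i j q)"
    by (rule sum.UNION_disjoint[symmetric]) (simp_all add: finite_triples, auto simp: triples_def)
  also have "\<dots> = (\<Sum>(i, j, q)\<in>{..A} \<times> {..B} \<times> {..<C}. f i j q)"
  proof (rule sum.mono_neutral_right)
    show "finite (\<Union>s\<in>{..R}. triples s)" by (simp add: finite_triples)
    show "{..A} \<times> {..B} \<times> {..<C} \<subseteq> (\<Union>s\<in>{..R}. triples s)"
      using assms(1) by (auto simp: triples_def)
    show "\<forall>x\<in>(\<Union>s\<in>{..R}. triples s) - {..A} \<times> {..B} \<times> {..<C}. (case x of (i, j, q) \<Rightarrow> f i j q) = 0"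
    proof
      fix x assume x: "x \<in> (\<Union>s\<in>{..R}. triples s) - {..A} \<times> {..B} \<times> {..<C}"
      obtain i j q where ijq: "x = (i, j, q)" by (cases x)
      have "i > A \<or> j > B \<or> q \<ge> C" using x unfolding ijq by auto
      then show "(case x of (i, j, q) \<Rightarrow> f i j q) = 0" unfolding ijq using assms(2) by simp
    qed
  qed
  also have "\<dots> = (\<Sum>i\<le>A. \<Sum>j\<le>B. \<Sum>q<C. f i j q)"
    by (simp add: sum.cartesian_product)
  finally show ?thesis .
qed

lemma minus_one_powi: "(-1::complex) powi x = (if even x then 1 else -1)"
  by (auto simp: power_int_def minus_one_power_iff even_nat_iff)

lemma sum_alternating_inverse_facts:
  "(\<Sum>s\<le>t. (-1) ^ s / (fact s * fact (t - s))) = (if t = 0 then 1 else 0 :: complex)"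
proof (cases "t = 0")
  case False
  have "(\<Sum>s\<le>t. (-1) ^ s / (fact s * fact (t - s))) =
      (\<Sum>s\<le>t. (-1) ^ s * of_nat (t choose s)) / (fact t :: complex)"
    unfolding sum_divide_distrib by (rule sum.cong[OF refl]) (simp add: binomial_fact)
  also have "\<dots> = 0" using choose_alternating_sum[of t, where 'a = complex] False by simp
  finally show ?thesis using False by simp
qed simp

section \<open>Graded spaces\<close>

text \<open>
  The vertex operator algebra, a module, its graded dual and its double dual are all instances.
\<close>

locale graded_space = vector_space s
  for s :: "complex \<Rightarrow> 'a::ab_group_add \<Rightarrow> 'a" +
  fixes W :: "'a set" and T :: "'a \<Rightarrow> 'a"
  assumes carrier_subspace: "subspace W"
    and grading_operator: "grading_operator s W T"
begin

abbreviation hom where "hom \<equiv> homog s W T"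
abbreviation comp where "comp \<equiv> component (homog s W T)"

lemma zero_in [simp]: "0 \<in> W" using carrier_subspace by (simp add: subspace_def)
lemma add_in: "x \<in> W \<Longrightarrow> y \<in> W \<Longrightarrow> x + y \<in> W" using carrier_subspace by (simp add: subspace_def)
lemma scale_in: "x \<in> W \<Longrightarrow> s c x \<in> W" using carrier_subspace by (simp add: subspace_def)

lemma T_in: "x \<in> W \<Longrightarrow> T x \<in> W"
  and T_add: "x \<in> W \<Longrightarrow> y \<in> W \<Longrightarrow> T (x + y) = T x + T y"
  and T_scale: "x \<in> W \<Longrightarrow> T (s c x) = s c (T x)"
  using grading_operator by (auto simp: grading_operator_def endo_on_def)

lemma T_additive: "additive_on W T" by (simp add: additive_on_def T_add)

lemma hom_subset: "x \<in> hom n \<Longrightarrow> x \<in> W" by (simp add: homog_def)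
lemma hom_T: "x \<in> hom n \<Longrightarrow> T x = s (of_nat n) x" by (simp add: homog_def)

lemma hom_subspace: "subspace (hom n)"
proof (rule subspaceI)
  show "0 \<in> hom n" using additive_on_zero[OF T_additive] by (simp add: homog_def)
  show "x + y \<in> hom n" if "x \<in> hom n" "y \<in> hom n" for x y
    using that by (simp add: homog_def add_in T_add scale_right_distrib)
  show "s c x \<in> hom n" if "x \<in> hom n" for c x
    using that by (simp add: homog_def scale_in T_scale mult.commute)
qed

lemma decomposition_component: "w \<in> W \<Longrightarrow> decomposition hom w (comp w)"
proof -
  assume "w \<in> W"
  then have "\<exists>!x. decomposition hom w x"
    using grading_operator by (simp add: grading_operator_def)
  then show ?thesis unfolding component_def by (rule theI')
qed

lemma component_unique: "w \<in> W \<Longrightarrow> decomposition hom w x \<Longrightarrow> comp w = x"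
  unfolding component_def by (rule the1_equality) (use grading_operator in \<open>simp_all add: grading_operator_def\<close>)

lemma component_in: "w \<in> W \<Longrightarrow> comp w n \<in> hom n"
  and component_finite: "w \<in> W \<Longrightarrow> finite {n. comp w n \<noteq> 0}"
  and component_Sum_any: "w \<in> W \<Longrightarrow> Sum_any (comp w) = w"
  by (drule decomposition_component, simp add: decomposition_def)+

lemma component_in_carrier: "w \<in> W \<Longrightarrow> comp w n \<in> W"
  using component_in hom_subset by blast

lemma component_homog:
  assumes "w \<in> hom d" shows "comp w n = (if n = d then w else 0)"
proof -
  have "decomposition hom w (\<lambda>n. if n = d then w else 0)"
    using assms subspace_0[OF hom_subspace] by (simp add: decomposition_def)
  then have "comp w = (\<lambda>n. if n = d then w else 0)"
    by (rule component_unique[OF hom_subset[OF assms]])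
  then show ?thesis by simp
qed

lemma component_add:
  assumes "x \<in> W" "y \<in> W" shows "comp (x + y) n = comp x n + comp y n"
proof -
  have "finite {n. comp x n + comp y n \<noteq> 0}"
    by (rule finite_subset[of _ "{n. comp x n \<noteq> 0} \<union> {n. comp y n \<noteq> 0}"])
      (use assms component_finite in auto)
  then have "decomposition hom (x + y) (\<lambda>n. comp x n + comp y n)"
    using assms
    by (simp add: decomposition_def component_in subspace_add[OF hom_subspace] Sum_any.distrib
        component_finite component_Sum_any)
  then have "comp (x + y) = (\<lambda>n. comp x n + comp y n)"
    by (rule component_unique[OF add_in[OF assms]])
  then show ?thesis by simp
qed

lemma component_scale:
  assumes "x \<in> W" shows "comp (s c x) n = s c (comp x n)"
proof -
  have "decomposition hom (s c x) (\<lambda>n. s c (comp x n))"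
    using assms
    by (simp add: decomposition_def component_in subspace_scale[OF hom_subspace] Sum_any_scale
        finite_support_scale component_finite component_Sum_any)
  then have "comp (s c x) = (\<lambda>n. s c (comp x n))"
    by (rule component_unique[OF scale_in[OF assms]])
  then show ?thesis by simp
qed

lemma component_eq_zero: "w \<in> W \<Longrightarrow> (\<And>n. comp w n = 0) \<Longrightarrow> w = 0"
  using component_Sum_any[of w] by simp

text \<open>
  Linear statements need only be proved for homogeneous vectors. There is no case for 0, which is
  homogeneous of every degree.
\<close>

lemma homogeneous_induct [consumes 1, case_names homog add]:
  assumes "w \<in> W"
    and homog: "\<And>n x. x \<in> hom n \<Longrightarrow> P x"
    and add: "\<And>x y. x \<in> W \<Longrightarrow> y \<in> W \<Longrightarrow> P x \<Longrightarrow> P y \<Longrightarrow> P (x + y)"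
  shows "P w"
proof -
  have "P 0" using homog[of 0 0] hom_subspace by (simp add: subspace_0)
  have "sum (comp w) A \<in> W \<and> P (sum (comp w) A)" if "finite A" for A
    using that
    by (induction A)
      (use \<open>w \<in> W\<close> in \<open>simp_all add: \<open>P 0\<close> add_in component_in_carrier add homog[OF component_in]\<close>)
  then have "P (sum (comp w) {n. comp w n \<noteq> 0})"
    using component_finite assms by auto
  then show ?thesis using component_Sum_any[OF \<open>w \<in> W\<close>] by (simp add: Sum_any.expand_set)
qed

lemma component_T: "w \<in> W \<Longrightarrow> comp (T w) n = s (of_nat n) (comp w n)"
proof (induction w rule: homogeneous_induct)
  case (homog m x)
  then show ?case
    by (simp add: hom_T[OF homog] component_scale[OF hom_subset[OF homog]] component_homog[OF homog])
qed (simp add: T_add component_add T_in scale_right_distrib)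

text \<open>
  The components of an eigenvector are eigenvectors for the eigenvalue \<open>c\<close> and for their own
  degree, so they all vanish.
\<close>

lemma eigenvalue_nat:
  assumes "w \<in> W" "T w = s c w" "\<And>n. c \<noteq> of_nat n" shows "w = 0"
proof (rule component_eq_zero)
  fix n
  have "s (of_nat n) (comp w n) = comp (T w) n" by (rule component_T[OF assms(1), symmetric])
  also have "\<dots> = s c (comp w n)" unfolding assms(2) by (rule component_scale[OF assms(1)])
  finally have "s (of_nat n - c) (comp w n) = 0" by (simp only: scale_left_diff_distrib diff_self)
  then show "comp w n = 0" using assms(3)[of n] by (simp only: scale_eq_0_iff right_minus_eq) auto
qed (rule assms(1))

text \<open>
  Degrees such as that of \<open>u\<^sub>n v\<close> are integers that may be negative. Indexing the eigenspaces by
  integers avoids a case distinction in each computation of a degree; the ones with a negative index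
  are 0.
\<close>

definition weight :: "int \<Rightarrow> 'a set" where
  "weight k = {w \<in> W. T w = s (of_int k) w}"

lemma weight_of_nat: "weight (int n) = hom n" by (simp add: weight_def homog_def)

lemma weight_neg:
  assumes "w \<in> weight k" "k < 0" shows "w = 0"
proof (rule eigenvalue_nat)
  show "w \<in> W" "T w = s (of_int k) w" using assms(1) by (simp_all add: weight_def)
  fix n
  have "k \<noteq> int n" using assms(2) by linarith
  then show "of_int k \<noteq> (of_nat n :: complex)"
    using of_int_eq_iff[of k "int n", where 'a = complex] by simp
qed

lemma weight_nonneg: "w \<in> weight k \<Longrightarrow> k \<ge> 0 \<Longrightarrow> w \<in> hom (nat k)"
  by (simp flip: weight_of_nat)

end

section \<open>The graded dual\<close>

lemma vector_space_scale_fun: "vector_space scale_fun"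
  by unfold_locales (simp_all add: scale_fun_def fun_eq_iff algebra_simps)

lemma scale_fun_apply: "scale_fun a f x = a * f x"
  by (simp add: scale_fun_def)

context graded_space
begin

abbreviation dual where "dual \<equiv> graded_dual s W T"
abbreviation dhom where "dhom \<equiv> dual_homog s W T"
abbreviation dualT where "dualT \<equiv> dual_L0 s W T"

text \<open>
  The elements of the full dual of \<open>W\<close>, extended by 0 outside \<open>W\<close>.
\<close>

definition form :: "('a \<Rightarrow> complex) \<Rightarrow> bool" where
  "form f \<longleftrightarrow> additive_on W f \<and> (\<forall>a. \<forall>x\<in>W. f (s a x) = a * f x) \<and> (\<forall>x. x \<notin> W \<longrightarrow> f x = 0)"

lemma form_additive: "form f \<Longrightarrow> additive_on W f"
  and form_scale: "form f \<Longrightarrow> x \<in> W \<Longrightarrow> f (s a x) = a * f x"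
  and form_outside: "form f \<Longrightarrow> x \<notin> W \<Longrightarrow> f x = 0"
  by (simp_all add: form_def)

lemma form_add: "form f \<Longrightarrow> x \<in> W \<Longrightarrow> y \<in> W \<Longrightarrow> f (x + y) = f x + f y"
  by (rule additive_onD[OF form_additive])

lemma form_zero: "form f \<Longrightarrow> f 0 = 0"
  by (rule additive_on_zero[OF form_additive]) auto

lemma dhom_iff: "f \<in> dhom n \<longleftrightarrow> form f \<and> (\<forall>m. m \<noteq> n \<longrightarrow> (\<forall>x\<in>hom m. f x = 0))"
  by (auto simp: dual_homog_def form_def additive_on_def)

lemma dhom_form: "f \<in> dhom n \<Longrightarrow> form f" by (simp add: dhom_iff)

lemma form_zero_fun: "form 0" and form_plus: "form f \<Longrightarrow> form g \<Longrightarrow> form (f + g)"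
  and form_scale_fun: "form f \<Longrightarrow> form (scale_fun a f)"
  by (simp_all add: form_def additive_on_def scale_fun_def algebra_simps)

lemma form_Sum_any: "(\<And>i. form (g i)) \<Longrightarrow> form (Sum_any g)"
proof -
  assume g: "\<And>i. form (g i)"
  have "form (sum g A)" for A
  proof (induction A rule: infinite_finite_induct)
    case (insert i A)
    then show ?case unfolding sum.insert[OF insert(1,2)] by (intro form_plus g)
  next
    case (infinite A)
    show ?case unfolding sum.infinite[OF infinite] by (rule form_zero_fun)
  qed (unfold sum.empty, rule form_zero_fun)
  then show ?thesis by (simp add: Sum_any.expand_set)
qed

lemma form_ext:
  assumes f: "form f" and g: "form g" and "\<And>n x. x \<in> hom n \<Longrightarrow> f x = g x"
  shows "f = g"
proof
  fix w show "f w = g w"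
  proof (cases "w \<in> W")
    case True then show ?thesis
      by (induction w rule: homogeneous_induct) (simp_all add: assms form_add)
  qed (simp add: form_outside f g)
qed

lemma form_component_sum: "form f \<Longrightarrow> w \<in> W \<Longrightarrow> f w = Sum_any (\<lambda>n. f (comp w n))"
  using additive_on_Sum_any[OF form_additive, of f "comp w"]
  by (simp add: component_Sum_any component_finite component_in_carrier add_in)

text \<open>
  The part of \<open>f\<close> of degree \<open>n\<close>, namely its restriction to the summand of degree \<open>n\<close>, extended by 0
  to the other summands.
\<close>

definition restrict_form :: "('a \<Rightarrow> complex) \<Rightarrow> nat \<Rightarrow> 'a \<Rightarrow> complex" where
  "restrict_form f n = (\<lambda>w. if w \<in> W then f (comp w n) else 0)"

lemma restrict_form_hom:
  "form f \<Longrightarrow> x \<in> hom m \<Longrightarrow> restrict_form f n x = (if n = m then f x else 0)"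
  using component_homog[of x m n] hom_subset[of x m]
  by (simp add: restrict_form_def form_zero)

lemma restrict_form_dhom: "form f \<Longrightarrow> restrict_form f n \<in> dhom n"
proof -
  assume f: "form f"
  have "form (restrict_form f n)"
    by (simp add: form_def additive_on_def restrict_form_def component_add component_scale add_in scale_in
        form_add[OF f] form_scale[OF f] component_in_carrier)
  then show ?thesis by (simp add: dhom_iff restrict_form_hom f)
qed

lemma dhom_component: "f \<in> dhom n \<Longrightarrow> w \<in> W \<Longrightarrow> f w = f (comp w n)"
proof -
  assume f: "f \<in> dhom n" and "w \<in> W"
  have "f = restrict_form f n"
    by (rule form_ext) (use f restrict_form_dhom[of f n] in \<open>auto simp: dhom_iff restrict_form_hom\<close>)
  then have "f w = restrict_form f n w" by simp
  also have "\<dots> = f (comp w n)" using \<open>w \<in> W\<close> by (simp add: restrict_form_def)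
  finally show ?thesis .
qed

text \<open>
  This turns out to characterize the graded dual (\<open>dual_iff\<close>), without reference to
  decompositions.
\<close>

definition bounded_form :: "('a \<Rightarrow> complex) \<Rightarrow> bool" where
  "bounded_form f \<longleftrightarrow> form f \<and> (\<exists>N. \<forall>m\<ge>N. \<forall>x\<in>hom m. f x = 0)"

lemma restrict_form_zero:
  assumes "form f" "\<And>x. x \<in> hom n \<Longrightarrow> f x = 0" shows "restrict_form f n = 0"
  by (rule form_ext)
    (use assms restrict_form_dhom[of f n] in \<open>auto simp: dhom_iff restrict_form_hom form_zero_fun\<close>)

lemma decomposition_restrict_form:
  assumes "bounded_form f" shows "decomposition dhom f (restrict_form f)"
proof -
  obtain N where f: "form f" and N: "\<And>m x. m \<ge> N \<Longrightarrow> x \<in> hom m \<Longrightarrow> f x = 0"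
    using assms by (auto simp: bounded_form_def)
  have fin: "finite {n. restrict_form f n \<noteq> 0}"
    by (rule finite_nat_support[of N]) (rule restrict_form_zero[OF f N])
  have "Sum_any (restrict_form f) = f"
  proof (rule form_ext)
    show "form (Sum_any (restrict_form f))" by (rule form_Sum_any) (rule dhom_form[OF restrict_form_dhom[OF f]])
    fix m x assume x: "x \<in> hom m"
    have "Sum_any (restrict_form f) x = Sum_any (\<lambda>n. restrict_form f n x)" by (rule Sum_any_apply[OF fin])
    also have "\<dots> = f x" by (simp add: restrict_form_hom[OF f x])
    finally show "Sum_any (restrict_form f) x = f x" .
  qed (rule f)
  then show ?thesis using fin by (simp add: decomposition_def restrict_form_dhom[OF f])
qed

text \<open>
  On vectors of degree \<open>m\<close> only the summand of degree \<open>m\<close> is nonzero, so \<open>f\<close> determines it; and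
  a finite sum has only finitely many degrees.
\<close>

lemma decomposition_dhom_unique:
  assumes "decomposition dhom f x" shows "bounded_form f" and "x = restrict_form f"
proof -
  have x: "\<And>n. x n \<in> dhom n" and fin: "finite {n. x n \<noteq> 0}" and f: "f = Sum_any x"
    using assms by (auto simp: decomposition_def)
  have form: "form f" unfolding f by (rule form_Sum_any) (rule dhom_form[OF x])
  have fx: "f y = x m y" if "y \<in> hom m" for m y
  proof -
    have "f y = Sum_any (\<lambda>n. x n y)" unfolding f by (rule Sum_any_apply[OF fin])
    also have "(\<lambda>n. x n y) = (\<lambda>n. if n = m then x n y else 0)"
    proof
      fix n
      have "n \<noteq> m \<Longrightarrow> x n y = 0" using x[of n] that unfolding dhom_iff by auto
      then show "x n y = (if n = m then x n y else 0)" by simp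
    qed
    finally show ?thesis by simp
  qed
  obtain N where N: "\<forall>n\<in>{n. x n \<noteq> 0}. n < N" using fin finite_nat_set_iff_bounded by blast
  have "x m = 0" if "m \<ge> N" for m
  proof (rule ccontr)
    assume "x m \<noteq> 0"
    then have "m < N" using N by blast
    then show False using that by simp
  qed
  then have "\<forall>m\<ge>N. \<forall>y\<in>hom m. f y = 0" by (simp add: fx)
  then show "bounded_form f" using form by (auto simp: bounded_form_def)
  show "x = restrict_form f"
  proof
    fix n show "x n = restrict_form f n"
    proof (rule form_ext)
      fix m y assume y: "y \<in> hom m"
      have "n \<noteq> m \<Longrightarrow> x n y = 0" using x[of n] y by (auto simp: dhom_iff)
      then show "x n y = restrict_form f n y" by (simp add: restrict_form_hom[OF form y] fx[OF y])
    qed (rule dhom_form[OF x], rule dhom_form[OF restrict_form_dhom[OF form]])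
  qed
qed

lemma dual_iff: "f \<in> dual \<longleftrightarrow> bounded_form f"
  using decomposition_dhom_unique(1) decomposition_restrict_form
  by (auto simp: graded_dual_def)

lemma dual_form: "f \<in> dual \<Longrightarrow> form f" by (simp add: dual_iff bounded_form_def)

lemma dual_bound: "f \<in> dual \<Longrightarrow> \<exists>N. \<forall>m\<ge>N. \<forall>x\<in>hom m. f x = 0" by (simp add: dual_iff bounded_form_def)

lemma dualI: "form f \<Longrightarrow> (\<And>m x. m \<ge> N \<Longrightarrow> x \<in> hom m \<Longrightarrow> f x = 0) \<Longrightarrow> f \<in> dual"
  by (auto simp: dual_iff bounded_form_def)

lemma dhom_subset_dual: "f \<in> dhom n \<Longrightarrow> f \<in> dual"
proof (rule dualI[of f "Suc n"])
  fix m x assume "f \<in> dhom n" "Suc n \<le> m" "x \<in> hom m"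
  moreover from this(2) have "m \<noteq> n" by simp
  ultimately show "f x = 0" unfolding dhom_iff by blast
qed (rule dhom_form)

lemma component_dhom: "f \<in> dual \<Longrightarrow> component dhom f = restrict_form f"
  unfolding component_def
  by (rule the_equality) (auto simp: dual_iff intro: decomposition_restrict_form decomposition_dhom_unique(2))

text \<open>
  The degree operator of the graded dual is the transpose of \<open>T\<close>: both sides are the sum of
  \<open>n * f (w\<^sub>n)\<close> over the components \<open>w\<^sub>n\<close> of \<open>w\<close>. This replaces the definition by
  components in all that follows.
\<close>

lemma dual_T_apply:
  assumes f: "f \<in> dual" and w: "w \<in> W" shows "dualT f w = f (T w)"
proof -
  have "finite {n. restrict_form f n \<noteq> 0}"
    using decomposition_restrict_form f by (auto simp: decomposition_def dual_iff)
  then have "finite {n. scale_fun (of_nat n) (restrict_form f n) \<noteq> 0}"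
    by (rule finite_subset[rotated]) (auto simp: scale_fun_def)
  then have "dualT f w = Sum_any (\<lambda>n. of_nat n * f (comp w n))"
    unfolding dual_L0_def component_dhom[OF f]
    using w by (simp add: Sum_any_apply) (simp add: scale_fun_def restrict_form_def)
  also have "\<dots> = f (T w)"
    using form_component_sum[OF dual_form[OF f] T_in[OF w]]
    by (simp add: component_T w form_scale[OF dual_form[OF f]] component_in_carrier)
  finally show ?thesis .
qed

lemma dual_T_outside:
  assumes f: "f \<in> dual" and w: "w \<notin> W" shows "dualT f w = 0"
proof -
  have "finite {n. restrict_form f n \<noteq> 0}"
    using decomposition_restrict_form f by (auto simp: decomposition_def dual_iff)
  then have "finite {n. scale_fun (of_nat n) (restrict_form f n) \<noteq> 0}"
    by (rule finite_subset[rotated]) (auto simp: scale_fun_def)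
  then show ?thesis
    unfolding dual_L0_def component_dhom[OF f]
    using w by (simp add: Sum_any_apply) (simp add: scale_fun_def restrict_form_def)
qed

lemma dual_plus:
  assumes f: "f \<in> dual" and g: "g \<in> dual" shows "f + g \<in> dual"
proof -
  obtain M where M: "\<forall>m\<ge>M. \<forall>x\<in>hom m. f x = 0" using dual_bound[OF f] by blast
  obtain N where N: "\<forall>m\<ge>N. \<forall>x\<in>hom m. g x = 0" using dual_bound[OF g] by blast
  show ?thesis
  proof (rule dualI[of _ "max M N"])
    show "form (f + g)" by (intro form_plus dual_form f g)
    show "(f + g) x = 0" if "max M N \<le> m" "x \<in> hom m" for m x
    proof -
      have "M \<le> m" "N \<le> m" using that(1) by simp_all
      then have "f x = 0" "g x = 0" using M N that(2) by blast+
      then show ?thesis by simp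
    qed
  qed
qed

lemma dual_scale:
  assumes f: "f \<in> dual" shows "scale_fun a f \<in> dual"
proof -
  obtain N where N: "\<forall>m\<ge>N. \<forall>x\<in>hom m. f x = 0" using dual_bound[OF f] by blast
  show ?thesis
  proof (rule dualI[of _ N])
    show "form (scale_fun a f)" by (intro form_scale_fun dual_form f)
    show "scale_fun a f x = 0" if "N \<le> m" "x \<in> hom m" for m x
    proof -
      have "f x = 0" using N that by blast
      then show ?thesis by (simp add: scale_fun_def)
    qed
  qed
qed

lemma dual_zero: "0 \<in> dual"
  by (rule dualI[OF form_zero_fun]) simp

lemma dual_subspace: "module.subspace scale_fun dual"
proof -
  interpret F: vector_space scale_fun by (rule vector_space_scale_fun)
  show ?thesis by (rule F.subspaceI) (simp_all add: dual_zero dual_plus dual_scale)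
qed

lemma dual_T_in: "f \<in> dual \<Longrightarrow> dualT f \<in> dual"
proof -
  assume f: "f \<in> dual"
  note form = dual_form[OF f]
  obtain N where N: "\<forall>m\<ge>N. \<forall>x\<in>hom m. f x = 0" using dual_bound[OF f] by blast
  have "form (dualT f)"
    by (simp add: form_def additive_on_def dual_T_apply[OF f] dual_T_outside[OF f] add_in scale_in T_add T_scale
        form_add[OF form] form_scale[OF form] T_in)
  moreover have "dualT f x = 0" if "m \<ge> N" "x \<in> hom m" for m x
  proof -
    have "f x = 0" using N that by blast
    then show ?thesis using hom_subset[OF that(2)]
      by (simp add: dual_T_apply[OF f] hom_T[OF that(2)] form_scale[OF form])
  qed
  ultimately show ?thesis by (rule dualI)
qed

text \<open>
  A form \<open>f\<close> is an eigenvector of the transpose of \<open>T\<close> for the eigenvalue \<open>n\<close> iff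
  \<open>m * f x = n * f x\<close> for all \<open>x\<close> of degree \<open>m\<close>, that is, iff it vanishes in the degrees other than
  \<open>n\<close>.
\<close>

lemma homog_dual: "homog scale_fun dual dualT = dhom"
proof (intro ext set_eqI iffI)
  fix n f assume f: "f \<in> dhom n"
  have "dualT f = scale_fun (of_nat n) f"
  proof (rule form_ext)
    show "form (dualT f)" by (rule dual_form[OF dual_T_in[OF dhom_subset_dual[OF f]]])
    show "form (scale_fun (of_nat n) f)" by (rule form_scale_fun[OF dhom_form[OF f]])
    fix m x assume x: "x \<in> hom m"
    have "dualT f x = of_nat m * f x"
      using hom_subset[OF x]
      by (simp add: dual_T_apply[OF dhom_subset_dual[OF f]] hom_T[OF x] form_scale[OF dhom_form[OF f]])
    also have "\<dots> = of_nat n * f x"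
      using f x by (cases "m = n") (auto simp: dhom_iff)
    finally show "dualT f x = scale_fun (of_nat n) f x" by (simp add: scale_fun_def)
  qed
  then show "f \<in> homog scale_fun dual dualT n" by (simp add: homog_def dhom_subset_dual[OF f])
next
  fix n f assume "f \<in> homog scale_fun dual dualT n"
  then have f: "f \<in> dual" and e: "dualT f = scale_fun (of_nat n) f" by (simp_all add: homog_def)
  have "f x = 0" if "m \<noteq> n" "x \<in> hom m" for m x
  proof -
    have "of_nat n * f x = dualT f x" by (simp add: e scale_fun_def)
    also have "\<dots> = of_nat m * f x"
      using hom_subset[OF that(2)]
      by (simp add: dual_T_apply[OF f] hom_T[OF that(2)] form_scale[OF dual_form[OF f]])
    finally show ?thesis using that(1) by simp
  qed
  then show "f \<in> dhom n" by (simp add: dhom_iff dual_form[OF f])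
qed

lemma dual_graded_space: "graded_space scale_fun dual dualT"
proof -
  interpret F: vector_space scale_fun by (rule vector_space_scale_fun)
  have "endo_on scale_fun dual dualT"
    unfolding endo_on_def
  proof (intro conjI ballI allI)
    fix f g assume f: "f \<in> dual" and g: "g \<in> dual"
    show "dualT (f + g) = dualT f + dualT g"
    proof
      fix w show "dualT (f + g) w = (dualT f + dualT g) w"
        by (cases "w \<in> W")
          (simp_all add: dual_T_apply dual_T_outside dual_plus f g)
    qed
  next
    fix f a assume f: "f \<in> dual"
    show "dualT (scale_fun a f) = scale_fun a (dualT f)"
    proof
      fix w show "dualT (scale_fun a f) w = scale_fun a (dualT f) w"
      proof (cases "w \<in> W")
        case True
        then have "dualT (scale_fun a f) w = scale_fun a f (T w)"
          by (intro dual_T_apply dual_scale f)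
        then show ?thesis using True by (simp add: scale_fun_def dual_T_apply f)
      next
        case False
        then have "dualT (scale_fun a f) w = 0"
          by (intro dual_T_outside dual_scale f)
        then show ?thesis using False by (simp add: scale_fun_def dual_T_outside f)
      qed
    qed
  qed (rule dual_T_in)
  moreover have "\<exists>!x. decomposition (homog scale_fun dual dualT) f x" if "f \<in> dual" for f
    unfolding homog_dual
    by (rule ex1I[of _ "restrict_form f"])
      (use that in \<open>auto simp: dual_iff intro: decomposition_restrict_form decomposition_dhom_unique(2)\<close>)
  ultimately show ?thesis
    by unfold_locales (simp_all add: dual_subspace grading_operator_def)
qed

end

section \<open>Finite-dimensional homogeneous components\<close>

locale finite_graded_space = graded_space +
  assumes finite_dimensional: "\<exists>B. finite B \<and> span B = hom n"
begin

lemma homogeneous_basis: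
  obtains B where "finite B" "independent B" "span B = hom n"
proof -
  obtain S where S: "finite S" "span S = hom n" using finite_dimensional by blast
  obtain B where B: "B \<subseteq> hom n" "independent B" "hom n \<subseteq> span B" "card B = dim (hom n)"
    by (rule basis_exists)
  have "finite B" using independent_span_bound[OF S(1) B(2)] B(1) S(2) by simp
  moreover have "span B = hom n"
    using span_minimal[OF B(1) hom_subspace] B(3) by (rule subset_antisym)
  ultimately show ?thesis using B(2) by (intro that)
qed

text \<open>
  The coordinate of the component of degree \<open>n\<close> along \<open>b\<close>, where \<open>B\<close> is a basis of the summand
  of degree \<open>n\<close>.
\<close>

definition dual_basis :: "'a set \<Rightarrow> nat \<Rightarrow> 'a \<Rightarrow> 'a \<Rightarrow> complex" where
  "dual_basis B n b = (\<lambda>w. if w \<in> W then representation B (comp w n) b else 0)"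

lemma dual_basis_dhom:
  assumes "independent B" "span B = hom n" shows "dual_basis B n b \<in> dhom n"
proof -
  have "form (dual_basis B n b)"
    by (simp add: form_def additive_on_def dual_basis_def add_in scale_in component_add component_scale
        representation_add[OF assms(1)] representation_scale[OF assms(1)] component_in assms(2))
  moreover have "dual_basis B n b x = 0" if "m \<noteq> n" "x \<in> hom m" for m x
    using that component_homog[OF that(2), of n] by (simp add: dual_basis_def representation_zero)
  ultimately show ?thesis unfolding dhom_iff by blast
qed

lemma dhom_expand:
  assumes B: "finite B" "independent B" "span B = hom n" and f: "f \<in> dhom n" and w: "w \<in> W"
  shows "f w = (\<Sum>b\<in>B. f b * dual_basis B n b w)"
proof -
  have form: "form f" using f by (rule dhom_form)
  have BW: "b \<in> W" if "b \<in> B" for b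
    using span_base[OF that] hom_subset[of b n] B(3) by simp
  have "f w = f (comp w n)" by (rule dhom_component[OF f w])
  also have "comp w n = (\<Sum>b\<in>B. s (representation B (comp w n) b) b)"
    by (rule sum_representation_eq[OF B(2) _ B(1), symmetric]) (simp_all add: B(3) component_in w)
  also have "f \<dots> = (\<Sum>b\<in>B. f (s (representation B (comp w n) b) b))"
    by (rule additive_on_sum[OF form_additive[OF form]]) (auto intro: add_in scale_in BW)
  also have "\<dots> = (\<Sum>b\<in>B. f b * dual_basis B n b w)"
    by (rule sum.cong[OF refl]) (simp add: form_scale[OF form] BW dual_basis_def w)
  finally show ?thesis .
qed

lemma dhom_sum_dual_basis:
  assumes B: "finite B" "independent B" "span B = hom n" and f: "f \<in> dhom n"
  shows "f = (\<Sum>b\<in>B. scale_fun (f b) (dual_basis B n b))"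
proof
  fix w
  have "(\<Sum>b\<in>B. scale_fun (f b) (dual_basis B n b)) w = (\<Sum>b\<in>B. f b * dual_basis B n b w)"
    by (subst additive_on_sum[where W = UNIV and h = "\<lambda>f. f w"])
      (simp_all add: additive_on_def scale_fun_def)
  then show "f w = (\<Sum>b\<in>B. scale_fun (f b) (dual_basis B n b)) w"
    using dhom_expand[OF B f, of w] form_outside[OF dhom_form[OF f], of w]
    by (cases "w \<in> W") (simp_all add: dual_basis_def)
qed

lemma finite_dimensional_dhom: "\<exists>C. finite C \<and> module.span scale_fun C = dhom n"
proof -
  interpret F: vector_space scale_fun by (rule vector_space_scale_fun)
  interpret D: graded_space scale_fun dual dualT by (rule dual_graded_space)
  obtain B where B: "finite B" "independent B" "span B = hom n" by (rule homogeneous_basis)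
  have "F.subspace (dhom n)" using D.hom_subspace[of n] unfolding homog_dual .
  then have "F.span (dual_basis B n ` B) \<subseteq> dhom n"
    by (intro F.span_minimal) (auto simp: dual_basis_dhom[OF B(2,3)])
  moreover have "f \<in> F.span (dual_basis B n ` B)" if f: "f \<in> dhom n" for f
  proof -
    have "f = (\<Sum>b\<in>B. scale_fun (f b) (dual_basis B n b))" by (rule dhom_sum_dual_basis[OF B f])
    also have "\<dots> \<in> F.span (dual_basis B n ` B)"
      by (intro F.span_sum F.span_scale F.span_base) simp
    finally show ?thesis .
  qed
  ultimately have "F.span (dual_basis B n ` B) = dhom n" by blast
  then show ?thesis using B(1) by blast
qed

end

context graded_space
begin

abbreviation ev where "ev \<equiv> eval_at dual"

lemma ev_apply: "f \<in> dual \<Longrightarrow> ev w f = f w" by (simp add: eval_at_def)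

lemma ev_add: "x \<in> W \<Longrightarrow> y \<in> W \<Longrightarrow> ev (x + y) = ev x + ev y"
  by (auto simp: eval_at_def fun_eq_iff form_add dual_form)

lemma ev_scale: "x \<in> W \<Longrightarrow> ev (s a x) = scale_fun a (ev x)"
  by (auto simp: eval_at_def scale_fun_def fun_eq_iff form_scale dual_form)

end

context finite_graded_space
begin

interpretation D: graded_space scale_fun dual dualT by (rule dual_graded_space)
interpretation DD: graded_space scale_fun D.dual D.dualT by (rule D.dual_graded_space)

lemma ev_form: "D.form (ev w)"
  by (simp add: D.form_def additive_on_def eval_at_def D.add_in D.scale_in) (simp add: scale_fun_def)

lemma ev_hom: "w \<in> hom n \<Longrightarrow> ev w \<in> D.dhom n"
proof -
  assume w: "w \<in> hom n"
  have "ev w f = 0" if "m \<noteq> n" "f \<in> D.hom m" for m f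
  proof -
    have f: "f \<in> dhom m" using that(2) unfolding homog_dual .
    then have "f w = 0" using w not_sym[OF that(1)] unfolding dhom_iff by blast
    then show ?thesis by (simp add: ev_apply dhom_subset_dual[OF f])
  qed
  then show ?thesis unfolding D.dhom_iff using ev_form by blast
qed

text \<open>
  A form \<open>p\<close> of degree \<open>n\<close> on the dual is the evaluation at the vector whose coordinates are the
  values of \<open>p\<close> on the dual basis.
\<close>

lemma ev_image_hom: "ev ` hom n = D.dhom n"
proof
  show "ev ` hom n \<subseteq> D.dhom n" using ev_hom by blast
  show "D.dhom n \<subseteq> ev ` hom n"
  proof
    fix p assume p: "p \<in> D.dhom n"
    obtain B where B: "finite B" "independent B" "span B = hom n" by (rule homogeneous_basis)
    have Bh: "b \<in> hom n" if "b \<in> B" for b using span_base[OF that] B(3) by simp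
    define w where "w = (\<Sum>b\<in>B. s (p (dual_basis B n b)) b)"
    have w: "w \<in> hom n"
      unfolding w_def by (intro subspace_sum[OF hom_subspace] subspace_scale[OF hom_subspace] Bh)
    have "p = ev w"
    proof (rule D.form_ext)
      show "D.form p" by (rule D.dhom_form[OF p])
      show "D.form (ev w)" by (rule ev_form)
      fix m f assume f: "f \<in> D.hom m"
      show "p f = ev w f"
      proof (cases "m = n")
        case False
        then have "p f = 0" "ev w f = 0"
          using p ev_hom[OF w] f unfolding D.dhom_iff by blast+
        then show ?thesis by simp
      next
        case True
        have fh: "f \<in> dhom n" using f unfolding homog_dual True .
        then have fd: "f \<in> dual" by (rule dhom_subset_dual)
        have bd: "dual_basis B n b \<in> dual" for b
          by (rule dhom_subset_dual[OF dual_basis_dhom[OF B(2,3)]])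
        have "p f = p (\<Sum>b\<in>B. scale_fun (f b) (dual_basis B n b))"
          using dhom_sum_dual_basis[OF B fh] by (rule arg_cong)
        also have "\<dots> = (\<Sum>b\<in>B. p (scale_fun (f b) (dual_basis B n b)))"
          by (rule additive_on_sum[OF D.form_additive[OF D.dhom_form[OF p]]])
            (auto intro: D.add_in D.scale_in bd)
        also have "\<dots> = (\<Sum>b\<in>B. p (dual_basis B n b) * f b)"
          by (rule sum.cong[OF refl]) (simp add: D.form_scale[OF D.dhom_form[OF p]] bd mult.commute)
        also have "\<dots> = (\<Sum>b\<in>B. f (s (p (dual_basis B n b)) b))"
          by (rule sum.cong[OF refl]) (simp add: form_scale[OF dual_form[OF fd]] hom_subset[OF Bh])
        also have "\<dots> = f w"
          unfolding w_def
          by (rule additive_on_sum[OF form_additive[OF dual_form[OF fd]], symmetric])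
            (auto intro: add_in scale_in hom_subset[OF Bh])
        finally show ?thesis by (simp add: ev_apply fd)
      qed
    qed
    then show "p \<in> ev ` hom n" using w by blast
  qed
qed

text \<open>
  Injectivity holds because the dual bases separate vectors, degree by degree. Surjectivity
  follows from the surjectivity in each degree, since the image is closed under addition.
\<close>

lemma ev_bij: "bij_betw ev W D.dual"
proof -
  have "inj_on ev W"
  proof (rule inj_onI)
    fix x y assume x: "x \<in> W" and y: "y \<in> W" and e: "ev x = ev y"
    have "comp x n = comp y n" for n
    proof -
      obtain B where B: "finite B" "independent B" "span B = hom n" by (rule homogeneous_basis)
      have "dual_basis B n b \<in> dual" for b
        by (rule dhom_subset_dual[OF dual_basis_dhom[OF B(2,3)]])
      then have "dual_basis B n b x = dual_basis B n b y" for b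
        using fun_cong[OF e, of "dual_basis B n b"] by (simp add: ev_apply)
      then have rep: "representation B (comp x n) b = representation B (comp y n) b" for b
        by (simp add: dual_basis_def x y)
      have expand: "(\<Sum>b\<in>B. s (representation B (comp z n) b) b) = comp z n" if "z \<in> W" for z
        by (rule sum_representation_eq[OF B(2) _ B(1)]) (simp_all add: B(3) component_in that)
      have "comp x n = (\<Sum>b\<in>B. s (representation B (comp x n) b) b)" by (rule expand[OF x, symmetric])
      also have "\<dots> = (\<Sum>b\<in>B. s (representation B (comp y n) b) b)" by (simp only: rep)
      also have "\<dots> = comp y n" by (rule expand[OF y])
      finally show ?thesis .
    qed
    then have xy: "comp x = comp y" by (rule ext)
    have "x = Sum_any (comp x)" by (rule component_Sum_any[OF x, symmetric])
    also have "\<dots> = y" unfolding xy by (rule component_Sum_any[OF y])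
    finally show "x = y" .
  qed
  moreover have "ev w \<in> D.dual" if "w \<in> W" for w
    using that
  proof (induction w rule: homogeneous_induct)
    case (homog n x)
    then show ?case by (intro D.dhom_subset_dual[of _ n] ev_hom)
  next
    case (add x y)
    then show ?case by (simp only: ev_add D.dual_plus)
  qed
  moreover have "p \<in> ev ` W" if "p \<in> D.dual" for p
    using that
  proof (induction p rule: DD.homogeneous_induct)
    case (homog n p)
    then have "p \<in> ev ` hom n" unfolding ev_image_hom D.homog_dual .
    then show ?case using hom_subset by blast
  next
    case (add p q)
    then obtain x y where "x \<in> W" "y \<in> W" "p = ev x" "q = ev y" by blast
    then have "p + q = ev (x + y)" "x + y \<in> W" by (simp_all only: ev_add add_in)
    then show ?case by blast
  qed
  ultimately show ?thesis unfolding bij_betw_def by blast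
qed

lemma ev_image_homog: "ev ` hom n = homog scale_fun D.dual D.dualT n"
  unfolding D.homog_dual by (rule ev_image_hom)

end

section \<open>The operator \<open>L\<^sub>1\<close> on a vertex operator algebra\<close>

context voa
begin

sublocale V: graded_space sV UNIV "L 0"
  using L0_grading by unfold_locales auto

lemma L_add: "L n (x + y) = L n x + L n y" and L_scale: "L n (sV c x) = sV c (L n x)"
  using L_endo by (auto simp: endo_on_def)

lemma Y_add_right: "Y v n (x + y) = Y v n x + Y v n y"
  and Y_scale_right: "Y v n (sV c x) = sV c (Y v n x)"
  using Y_endo by (auto simp: endo_on_def)

lemma L_zero: "L n 0 = 0" using L_scale[of n 0 0] by simp
lemma Y_zero: "Y 0 n w = 0" using Y_scale[of 0 0 n w] by simp
lemma Y_zero_right: "Y v n 0 = 0" using Y_scale_right[of v n 0 0] by simp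

lemma weightD: "v \<in> V.weight d \<Longrightarrow> L 0 v = sV (of_int d) v" by (simp add: V.weight_def)

lemma weight_mode:
  assumes "u \<in> V.weight d" "v \<in> V.weight e"
  shows "Y u n v \<in> V.weight (d + e - n - 1)"
proof -
  have "L 0 (Y u n v) = Y u n (L 0 v) + Y (L 0 u) n v - sV (of_int (n + 1)) (Y u n v)"
    using grading[of u n v] by (simp add: algebra_simps)
  then show ?thesis using assms
    by (simp add: V.weight_def Y_scale Y_scale_right flip: scale_left_distrib scale_left_diff_distrib)
qed

lemma weight_L1: "v \<in> V.weight d \<Longrightarrow> L 1 v \<in> V.weight (d - 1)"
proof -
  assume v: "v \<in> V.weight d"
  obtain c where vir: "\<And>m n v. L m (L n v) - L n (L m v) =
      sV (of_int (m - n)) (L (m + n) v) +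
      (if m = - n then sV (c / 12 * of_int ((m + 1) * m * (m - 1))) v else 0)"
    using virasoro by blast
  have "L 0 (L 1 v) = sV (of_int (d - 1)) (L 1 v)"
    using vir[of 0 1 v] v by (simp add: V.weight_def L_scale scale_left_diff_distrib algebra_simps)
  then show ?thesis by (simp add: V.weight_def)
qed

lemma weight_L1_pow: "v \<in> V.weight d \<Longrightarrow> (L 1 ^^ i) v \<in> V.weight (d - int i)"
proof (induction i)
  case (Suc i)
  then have "L 1 ((L 1 ^^ i) v) \<in> V.weight (d - int i - 1)" by (intro weight_L1) simp
  moreover have "d - int (Suc i) = d - int i - 1" by simp
  ultimately show ?case by (simp only: funpow.simps o_apply)
qed simp

lemma L1_pow_zero: "v \<in> V.weight d \<Longrightarrow> int i > d \<Longrightarrow> (L 1 ^^ i) v = 0"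
  by (rule V.weight_neg[OF weight_L1_pow[of v d i]]) simp_all

text \<open>
  If \<open>u\<close> and \<open>v\<close> have degrees \<open>d\<close> and \<open>e\<close>, then \<open>u\<^sub>n v\<close> has degree \<open>d + e - n - 1\<close>, which is
  negative for large \<open>n\<close>.
\<close>

lemma Y_truncation: "\<exists>N. \<forall>n\<ge>N. Y u n v = 0"
proof -
  have "u \<in> UNIV" "v \<in> UNIV" by auto
  from this(1) show ?thesis
  proof (induction u rule: V.homogeneous_induct)
    case (homog d u)
    note u = homog
    show ?case using \<open>v \<in> UNIV\<close>
    proof (induction v rule: V.homogeneous_induct)
      case (homog e v)
      have "Y u n v = 0" if "n \<ge> int d + int e" for n
        by (rule V.weight_neg[OF weight_mode[of u "int d" v "int e" n]])
          (use that u homog in \<open>simp_all add: V.weight_of_nat\<close>)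
      then show ?case by blast
    next
      case (add x y)
      then obtain M N where "\<forall>n\<ge>M. Y u n x = 0" "\<forall>n\<ge>N. Y u n y = 0" by blast
      then show ?case by (intro exI[of _ "max M N"]) (auto simp: Y_add_right)
    qed
  next
    case (add x y)
    then obtain M N where "\<forall>n\<ge>M. Y x n v = 0" "\<forall>n\<ge>N. Y y n v = 0" by blast
    then show ?case by (intro exI[of _ "max M N"]) (auto simp: Y_add)
  qed
qed

lemma finite_support_Y: "finite {l::nat. Y u (n + int l) v \<noteq> 0}"
proof -
  obtain N where "\<forall>k\<ge>N. Y u k v = 0" using Y_truncation by blast
  then have "Y u (n + int l) v = 0" if "l \<ge> nat (N - n)" for l using that by simp
  then show ?thesis by (rule finite_nat_support)
qed

lemma Jacobi:
  "Sum_any (\<lambda>l::nat. sV (of_int m gchoose l) (Y (Y u (n + int l) v) (m + k - int l) w)) =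
   Sum_any (\<lambda>l::nat. sV ((-1) ^ l * (of_int n gchoose l)) (Y u (m + n - int l) (Y v (k + int l) w))) -
   Sum_any (\<lambda>l::nat. sV ((-1) powi (n + int l) * (of_int n gchoose l))
     (Y v (n + k - int l) (Y u (m + int l) w)))"
  by (rule jacobi[unfolded jacobi_identity_def, rule_format, OF UNIV_I])

lemma commutator:
  "Y u m (Y v k w) - Y v k (Y u m w) =
   Sum_any (\<lambda>l::nat. sV (of_int m gchoose l) (Y (Y u (int l) v) (m + k - int l) w))"
proof -
  have "Sum_any (\<lambda>l::nat. sV ((-1) ^ l * (of_int 0 gchoose l)) (Y u (m + 0 - int l) (Y v (k + int l) w)))
      = Y u m (Y v k w)"
    by (subst Sum_any_eq_sum[of "{0}"]) (auto simp: gbinomial_0_left)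
  moreover have "Sum_any (\<lambda>l::nat. sV ((-1) powi (0 + int l) * (of_int 0 gchoose l))
      (Y v (0 + k - int l) (Y u (m + int l) w))) = Y v k (Y u m w)"
    by (subst Sum_any_eq_sum[of "{0}"]) (auto simp: gbinomial_0_left)
  ultimately show ?thesis using Jacobi[of m u 0 v k w] by simp
qed

lemma Y_L_minus1: "Y (L (-1) u) n v = - sV (of_int n) (Y u (n - 1) v)"
proof -
  have "Sum_any (\<lambda>l::nat. sV (of_int 0 gchoose l) (Y (Y conf (int l) u) (0 + n - int l) v)) = Y (Y conf 0 u) n v"
    by (subst Sum_any_eq_sum[of "{0}"]) (auto simp: gbinomial_0_left)
  then show ?thesis using translation[of u n v] commutator[of conf 0 u n v] by (simp add: conformal)
qed

text \<open>
  This is the commutator formula for \<open>L\<^sub>1\<close>, which is the mode of the conformal vector with index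
  2. The terms with \<open>l = 0, 1, 2\<close> are \<open>(L\<^sub>-\<^sub>1 u)\<^sub>n\<^sub>+\<^sub>2 = - (n + 2) u\<^sub>n\<^sub>+\<^sub>1\<close>, \<open>2 (L\<^sub>0 u)\<^sub>n\<^sub>+\<^sub>1 = 2d u\<^sub>n\<^sub>+\<^sub>1\<close> and
  \<open>(L\<^sub>1 u)\<^sub>n\<close>, and the other binomial coefficients vanish.
\<close>

lemma L1_mode:
  assumes "u \<in> V.weight d"
  shows "L 1 (Y u n v) = Y (L 1 u) n v + Y u n (L 1 v) + sV (of_int (2 * d - n - 2)) (Y u (n + 1) v)"
proof -
  have three: "{..<3::nat} = {0, 1, 2}" by auto
  have vanish: "2 gchoose l = (0::complex)" if "l \<ge> 3" for l
    using that binomial_gbinomial[of 2 l, where 'a = complex] by (simp add: binomial_eq_0)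
  have two: "2 gchoose 2 = (1::complex)"
    using binomial_gbinomial[of 2 2, where 'a = complex] by simp
  have "Sum_any (\<lambda>l::nat. sV (of_int 2 gchoose l) (Y (Y conf (int l) u) (2 + n - int l) v))
     = Y (Y conf 0 u) (n + 2) v + sV 2 (Y (Y conf 1 u) (n + 1) v) + Y (Y conf 2 u) n v"
    by (subst Sum_any_eq_sum_lessThan[of 3])
       (use two vanish in \<open>auto simp: three algebra_simps\<close>)
  with commutator[of conf 2 u n v]
  have "L 1 (Y u n v) = Y u n (L 1 v) + Y (L (-1) u) (n + 2) v + sV 2 (Y (L 0 u) (n + 1) v)
      + Y (L 1 u) n v"
    by (simp add: conformal algebra_simps)
  also have "Y (L (-1) u) (n + 2) v = - sV (of_int (n + 2)) (Y u (n + 1) v)"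
    using Y_L_minus1[of u "n + 2" v] by (simp add: algebra_simps)
  also have "sV 2 (Y (L 0 u) (n + 1) v) = sV (of_int (2 * d)) (Y u (n + 1) v)"
    using assms by (simp add: V.weight_def Y_scale)
  finally show ?thesis by (simp add: scale_left_diff_distrib scale_left_distrib algebra_simps)
qed

lemma L_additive: "additive_on UNIV (L n)"
  by (simp add: additive_on_def L_add)

lemma L1_pow_add: "(L 1 ^^ i) (x + y) = (L 1 ^^ i) x + (L 1 ^^ i) y"
  by (induction i) (simp_all add: L_add)

lemma L1_pow_scale: "(L 1 ^^ i) (sV c x) = sV c ((L 1 ^^ i) x)"
  by (induction i) (simp_all add: L_scale)

lemma L1_pow_of_zero: "(L 1 ^^ i) 0 = 0"
  by (induction i) (simp_all add: L_zero)

text \<open>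
  The expansion of \<open>exp (x L\<^sub>1) (Y(u, z) v)\<close>, coefficient by coefficient. By \<open>L1_mode\<close>, the operator
  \<open>L\<^sub>1\<close> acts on \<open>(L\<^sub>1\<^sup>i u)\<^sub>n\<^sub>+\<^sub>q L\<^sub>1\<^sup>j v\<close> by raising one of \<open>i\<close>, \<open>j\<close> and \<open>q\<close>. The induction on \<open>s\<close>
  collects the three contributions to each triple.
\<close>

lemma L1_pow_mode:
  assumes u: "u \<in> V.weight d"
  shows "sV (1 / fact s) ((L 1 ^^ s) (Y u n v)) =
    (\<Sum>(i, j, q)\<in>triples s. sV (1 / (fact i * fact j) * ((of_int (2 * d - n - 2) - of_nat i) gchoose q))
       (Y ((L 1 ^^ i) u) (n + int q) ((L 1 ^^ j) v)))"
proof (induction s)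
  case 0
  have "triples 0 = {(0, 0, 0)}" by (auto simp: triples_def)
  then show ?case by simp
next
  case (Suc s)
  define N :: complex where "N = of_int (2 * d - n - 2)"
  define X where "X i j q = Y ((L 1 ^^ i) u) (n + int q) ((L 1 ^^ j) v)" for i j q
  define c where "c i j q = 1 / (fact i * fact j) * ((N - of_nat i) gchoose q)" for i j q :: nat
  \<comment> \<open>The contributions to the triple (i, j, q) that come from raising i, j and q, respectively.\<close>
  define f1 where "f1 i j q = of_nat i / (fact i * fact j) * ((N - of_nat i + 1) gchoose q)" for i j q :: nat
  define f2 where "f2 i j q = of_nat j * c i j q" for i j q :: nat
  define f3 where "f3 i j q = 1 / (fact i * fact j) *
     (if q = 0 then 0 else (N - 2 * of_nat i - of_nat (q - 1)) * ((N - of_nat i) gchoose (q - 1)))" for i j q :: nat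
  have L1X: "L 1 (X i j q) = X (Suc i) j q + X i (Suc j) q + sV (N - 2 * of_nat i - of_nat q) (X i j (Suc q))"
    for i j q
    using L1_mode[OF weight_L1_pow[OF u, of i], of "n + int q" "(L 1 ^^ j) v"]
    by (simp add: X_def N_def algebra_simps)
  have "L 1 (sV (c i j q) (X i j q)) = sV (f1 (Suc i) j q) (X (Suc i) j q) +
      sV (f2 i (Suc j) q) (X i (Suc j) q) + sV (f3 i j (Suc q)) (X i j (Suc q))" for i j q
  proof -
    have cancel: "of_nat (Suc i) / (fact (Suc i) * fact j) = (1 / (fact i * fact j) :: complex)"
      by (simp add: fact_Suc del: of_nat_Suc)
    have shift: "N - of_nat (Suc i) + 1 = N - of_nat i" by simp
    have cancel': "of_nat (Suc j) * (1 / (fact i * fact (Suc j))) = (1 / (fact i * fact j) :: complex)"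
      by (simp add: fact_Suc del: of_nat_Suc)
    have "f1 (Suc i) j q = c i j q" unfolding f1_def c_def shift cancel ..
    moreover have "f2 i (Suc j) q = c i j q"
      unfolding f2_def c_def mult.assoc[symmetric] cancel' ..
    moreover have "f3 i j (Suc q) = c i j q * (N - 2 * of_nat i - of_nat q)"
      by (simp add: f3_def c_def mult_ac)
    ultimately show ?thesis by (simp add: L_scale L1X scale_right_distrib)
  qed
  then have "(\<Sum>(i, j, q)\<in>triples s. L 1 (sV (c i j q) (X i j q))) =
      (\<Sum>(i, j, q)\<in>triples s. sV (f1 (Suc i) j q) (X (Suc i) j q)) +
      (\<Sum>(i, j, q)\<in>triples s. sV (f2 i (Suc j) q) (X i (Suc j) q)) +
      (\<Sum>(i, j, q)\<in>triples s. sV (f3 i j (Suc q)) (X i j (Suc q)))"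
    by (simp add: case_prod_beta sum.distrib)
  also have "\<dots> = (\<Sum>(i, j, q)\<in>triples (Suc s). sV (f1 i j q) (X i j q)) +
      (\<Sum>(i, j, q)\<in>triples (Suc s). sV (f2 i j q) (X i j q)) +
      (\<Sum>(i, j, q)\<in>triples (Suc s). sV (f3 i j q) (X i j q))"
    using sum_triples_shift1[of "\<lambda>i j q. sV (f1 i j q) (X i j q)" s]
      sum_triples_shift2[of "\<lambda>i j q. sV (f2 i j q) (X i j q)" s]
      sum_triples_shift3[of "\<lambda>i j q. sV (f3 i j q) (X i j q)" s]
    by (simp add: f1_def f2_def f3_def)
  also have "\<dots> = (\<Sum>(i, j, q)\<in>triples (Suc s). sV (f1 i j q + f2 i j q + f3 i j q) (X i j q))"
    by (simp add: case_prod_beta sum.distrib scale_left_distrib)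
  also have "\<dots> = (\<Sum>(i, j, q)\<in>triples (Suc s). sV (of_nat (Suc s)) (sV (c i j q) (X i j q)))"
  proof (intro sum.cong refl, clarify)
    fix i j q assume "(i, j, q) \<in> triples (Suc s)"
    then have s: "of_nat (Suc s) = (of_nat i + of_nat j + of_nat q :: complex)"
      by (simp add: triples_def del: of_nat_Suc flip: of_nat_add)
    have "f1 i j q + f3 i j q = 1 / (fact i * fact j) *
       (of_nat i * ((N - of_nat i + 1) gchoose q) +
        (if q = 0 then 0 else ((N - of_nat i) - of_nat i - of_nat (q - 1)) * ((N - of_nat i) gchoose (q - 1))))"
      unfolding f1_def f3_def by (simp add: algebra_simps)
    also have "\<dots> = (of_nat i + of_nat q) * c i j q"
      unfolding gbinomial_recurrence by (simp add: c_def)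
    finally have "f1 i j q + f2 i j q + f3 i j q = of_nat (Suc s) * c i j q"
      unfolding s by (simp add: f2_def algebra_simps)
    then show "sV (f1 i j q + f2 i j q + f3 i j q) (X i j q) = sV (of_nat (Suc s)) (sV (c i j q) (X i j q))"
      by simp
  qed
  also have "\<dots> = sV (of_nat (Suc s)) (\<Sum>(i, j, q)\<in>triples (Suc s). sV (c i j q) (X i j q))"
    by (simp add: case_prod_beta scale_sum_right)
  finally have step: "(\<Sum>(i, j, q)\<in>triples s. L 1 (sV (c i j q) (X i j q))) =
    sV (of_nat (Suc s)) (\<Sum>(i, j, q)\<in>triples (Suc s). sV (c i j q) (X i j q))" .
  have "sV (1 / fact (Suc s)) ((L 1 ^^ Suc s) (Y u n v)) =
      sV (1 / of_nat (Suc s)) (L 1 (sV (1 / fact s) ((L 1 ^^ s) (Y u n v))))"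
    by (simp add: L_scale fact_Suc del: of_nat_Suc)
  also have "sV (1 / fact s) ((L 1 ^^ s) (Y u n v)) = (\<Sum>(i, j, q)\<in>triples s. sV (c i j q) (X i j q))"
    unfolding Suc.IH by (simp add: c_def X_def N_def)
  also have "L 1 \<dots> = (\<Sum>(i, j, q)\<in>triples s. L 1 (sV (c i j q) (X i j q)))"
    by (subst additive_on_sum[OF L_additive]) (auto simp: case_prod_beta)
  finally have "sV (1 / fact (Suc s)) ((L 1 ^^ Suc s) (Y u n v)) =
      (\<Sum>(i, j, q)\<in>triples (Suc s). sV (c i j q) (X i j q))"
    unfolding step by (simp del: of_nat_Suc)
  then show ?case by (simp only: c_def X_def N_def)
qed

end

section \<open>Adjoint modes\<close>

context voa
begin

abbreviation cvec where "cvec \<equiv> contragredient_vector sV L"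
abbreviation mpow where "mpow \<equiv> minus_z_inv_sq_pow sV (L 0)"

lemma exp_z_additive: "additive_on UNIV (\<lambda>v. exp_z sV (L 1) v k)"
  by (simp add: additive_on_def exp_z_def L1_pow_add scale_right_distrib)

lemma exp_z_zero: "exp_z sV (L 1) 0 k = 0"
  by (simp add: exp_z_def L1_pow_of_zero)

lemma mpow_homog:
  assumes "v \<in> V.hom d" shows "mpow v k = (if k = - 2 * int d then sV ((-1) ^ d) v else 0)"
  unfolding minus_z_inv_sq_pow_def
  by (subst Sum_any_eq_sum[of "{d}"]) (auto simp: V.component_homog[OF assms])

lemma mpow_add: "mpow (x + y) k = mpow x k + mpow y k"
proof -
  define g where "g v d = (if k = - 2 * int d then sV ((-1) ^ d) (V.comp v d) else 0)" for v d
  have "finite {d. g v d \<noteq> 0}" for v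
    by (rule finite_subset[OF _ V.component_finite[of v]]) (auto simp: g_def)
  moreover have "g (x + y) = (\<lambda>d. g x d + g y d)"
    by (auto simp: g_def V.component_add scale_right_distrib)
  ultimately show ?thesis
    unfolding minus_z_inv_sq_pow_def g_def[symmetric] by (simp add: Sum_any.distrib)
qed

lemma finite_mpow: "finite {k. mpow v k \<noteq> 0}"
proof -
  have "v \<in> UNIV" ..
  then show ?thesis
  proof (induction v rule: V.homogeneous_induct)
    case (homog n x)
    show ?case by (rule finite_subset[of _ "{- 2 * int n}"]) (auto simp: mpow_homog[OF homog])
  next
    case (add x y)
    then have "finite ({k. mpow x k \<noteq> 0} \<union> {k. mpow y k \<noteq> 0})" by simp
    then show ?case by (rule finite_subset[rotated]) (auto simp: mpow_add)
  qed
qed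

lemma cvec_add: "cvec (x + y) k = cvec x k + cvec y k"
proof -
  have fin: "finite {j. exp_z sV (L 1) (mpow v j) (k - j) \<noteq> 0}" for v
    by (rule finite_subset[OF _ finite_mpow[of v]]) (auto simp: exp_z_zero)
  have "exp_z sV (L 1) (mpow (x + y) j) (k - j) =
      exp_z sV (L 1) (mpow x j) (k - j) + exp_z sV (L 1) (mpow y j) (k - j)" for j
    by (simp add: mpow_add additive_onD[OF exp_z_additive])
  then show ?thesis
    unfolding contragredient_vector_def by (simp add: Sum_any.distrib[OF fin fin])
qed

text \<open>
  The series for a vector of degree \<open>d\<close> starts in degree \<open>- 2 d\<close> of \<open>z\<close>.
\<close>

lemma cvec_homog:
  assumes "v \<in> V.hom d"
  shows "cvec v k = (if k + 2 * int d \<ge> 0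
    then sV ((-1) ^ d / fact (nat (k + 2 * int d))) ((L 1 ^^ nat (k + 2 * int d)) v) else 0)"
proof -
  have "cvec v k = exp_z sV (L 1) (sV ((-1) ^ d) v) (k - (- 2 * int d))"
    unfolding contragredient_vector_def
    by (subst Sum_any_eq_sum[of "{- 2 * int d}"]) (auto simp: mpow_homog[OF assms] exp_z_zero)
  then show ?thesis by (simp add: exp_z_def L1_pow_scale)
qed

lemma finite_cvec: "finite {k. cvec v k \<noteq> 0}"
proof -
  have "v \<in> UNIV" ..
  then show ?thesis
  proof (induction v rule: V.homogeneous_induct)
    case (homog d x)
    have "x \<in> V.weight (int d)" using homog by (simp add: V.weight_of_nat)
    have "k \<in> {- 2 * int d..- int d}" if "cvec x k \<noteq> 0" for k
    proof -
      have "k + 2 * int d \<ge> 0" "(L 1 ^^ nat (k + 2 * int d)) x \<noteq> 0"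
        using that by (auto simp: cvec_homog[OF homog] split: if_splits)
      moreover from this(2) have "\<not> int d < int (nat (k + 2 * int d))"
        by (rule contrapos_nn) (rule L1_pow_zero[OF \<open>x \<in> V.weight (int d)\<close>])
      ultimately have "- 2 * int d \<le> k" "k \<le> - int d" by linarith+
      then show ?thesis by simp
    qed
    then have "{k. cvec x k \<noteq> 0} \<subseteq> {- 2 * int d..- int d}" by blast
    then show ?case by (rule finite_subset) simp
  next
    case (add x y)
    then have "finite ({k. cvec x k \<noteq> 0} \<union> {k. cvec y k \<noteq> 0})" by simp
    then show ?case by (rule finite_subset[rotated]) (auto simp: cvec_add)
  qed
qed

text \<open>
  The terms after the one of index \<open>d\<close> vanish because \<open>L\<^sub>1\<close> lowers the degree. Both the formula for
  the adjoint modes and their involutivity use this with a suitable \<open>H\<close>.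
\<close>

lemma Sum_any_cvec:
  assumes v: "v \<in> V.hom d" and H: "\<And>k. H 0 k = 0"
  shows "Sum_any (\<lambda>k. H (cvec v k) k) =
    (\<Sum>i\<le>d. H (sV ((-1) ^ d / fact i) ((L 1 ^^ i) v)) (int i - 2 * int d))"
proof -
  have vw: "v \<in> V.weight (int d)" using v by (simp add: V.weight_of_nat)
  have "Sum_any (\<lambda>k. H (cvec v k) k) = (\<Sum>k\<in>(\<lambda>i. int i - 2 * int d) ` {..d}. H (cvec v k) k)"
  proof (rule Sum_any_eq_sum)
    fix k assume k: "k \<notin> (\<lambda>i. int i - 2 * int d) ` {..d}"
    have "cvec v k = 0"
    proof (cases "k + 2 * int d \<ge> 0")
      case True
      have "nat (k + 2 * int d) \<notin> {..d}"
      proof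
        assume "nat (k + 2 * int d) \<in> {..d}"
        moreover have "k = int (nat (k + 2 * int d)) - 2 * int d" using True by simp
        ultimately show False using k by blast
      qed
      then have "int d < int (nat (k + 2 * int d))" unfolding atMost_iff by linarith
      then have "(L 1 ^^ nat (k + 2 * int d)) v = 0" by (rule L1_pow_zero[OF vw])
      then show ?thesis unfolding cvec_homog[OF v] by (simp del: nat_eq_iff)
    qed (simp add: cvec_homog[OF v])
    then show "H (cvec v k) k = 0" by (simp add: H)
  qed simp
  also have "\<dots> = (\<Sum>i\<le>d. H (cvec v (int i - 2 * int d)) (int i - 2 * int d))"
    by (subst sum.reindex) (auto simp: inj_on_def)
  finally show ?thesis by (simp add: cvec_homog[OF v])
qed

end

context weak_module
begin

lemma W_zero [simp]: "0 \<in> W" and W_add: "x \<in> W \<Longrightarrow> y \<in> W \<Longrightarrow> x + y \<in> W"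
  and W_scale: "x \<in> W \<Longrightarrow> sW c x \<in> W"
  using W_subspace by (auto simp: W.subspace_def)

lemma YW_in: "w \<in> W \<Longrightarrow> YW v n w \<in> W"
  and YW_add_right: "x \<in> W \<Longrightarrow> y \<in> W \<Longrightarrow> YW v n (x + y) = YW v n x + YW v n y"
  and YW_scale_right: "x \<in> W \<Longrightarrow> YW v n (sW c x) = sW c (YW v n x)"
  using YW_endo[of v n] by (auto simp: endo_on_def)

lemma YW_additive: "w \<in> W \<Longrightarrow> additive_on UNIV (\<lambda>v. YW v n w)"
  and YW_additive_right: "additive_on W (YW v n)"
  by (simp_all add: additive_on_def YW_add YW_add_right)

lemma YW_zero: "w \<in> W \<Longrightarrow> YW 0 n w = 0"
  by (rule additive_on_zero[OF YW_additive]) auto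

lemma YW_zero_right: "YW v n 0 = 0"
  by (rule additive_on_zero[OF YW_additive_right]) auto

lemma YW_Jacobi:
  "w \<in> W \<Longrightarrow>
   Sum_any (\<lambda>l::nat. sW (of_int m gchoose l) (YW (Y u (n + int l) v) (m + k - int l) w)) =
   Sum_any (\<lambda>l::nat. sW ((-1) ^ l * (of_int n gchoose l)) (YW u (m + n - int l) (YW v (k + int l) w))) -
   Sum_any (\<lambda>l::nat. sW ((-1) powi (n + int l) * (of_int n gchoose l))
     (YW v (n + k - int l) (YW u (m + int l) w)))"
  by (rule YW_jacobi[unfolded jacobi_identity_def, rule_format])

text \<open>
  Adjoint modes compose in the reverse order, so that the products of the two binomial sums of the
  Jacobi identity occur in exchanged positions. Moving a product from one position to the other
  multiplies its sum by \<open>(-1) powi n\<close>; the exchange of minuend and subtrahend gives the minus sign.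
\<close>

lemma YW_Jacobi_reversed:
  assumes "w \<in> W"
  shows "Sum_any (\<lambda>l::nat. sW ((-1) ^ l * (of_int n gchoose l)) (YW v (n + k - int l) (YW u (m + int l) w))) -
   Sum_any (\<lambda>l::nat. sW ((-1) powi (n + int l) * (of_int n gchoose l))
     (YW u (m + n - int l) (YW v (k + int l) w))) =
   sW (- ((-1) powi n)) (Sum_any (\<lambda>l::nat. sW (of_int m gchoose l) (YW (Y u (n + int l) v) (m + k - int l) w)))"
proof -
  have sq: "(-1) powi n * (-1) powi n = (1::complex)"
    by (simp flip: power_int_mult_distrib)
  have pw: "(-1) powi (n + int l) = (-1) powi n * ((-1) ^ l :: complex)" for l
    by (simp add: power_int_add)
  have e: "(-1) ^ l * c = (-1) powi n * ((-1) powi (n + int l) * (c::complex))" for l c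
    using sq by (simp add: pw)
  have "Sum_any (\<lambda>l::nat. sW ((-1) ^ l * (of_int n gchoose l)) (YW v (n + k - int l) (YW u (m + int l) w)))
    = sW ((-1) powi n) (Sum_any (\<lambda>l::nat. sW ((-1) powi (n + int l) * (of_int n gchoose l))
      (YW v (n + k - int l) (YW u (m + int l) w))))"
    by (simp only: W.Sum_any_scale[symmetric] W.scale_scale e[symmetric])
  moreover have "Sum_any (\<lambda>l::nat. sW ((-1) powi (n + int l) * (of_int n gchoose l))
      (YW u (m + n - int l) (YW v (k + int l) w))) =
    sW ((-1) powi n) (Sum_any (\<lambda>l::nat. sW ((-1) ^ l * (of_int n gchoose l))
      (YW u (m + n - int l) (YW v (k + int l) w))))"
    by (simp only: W.Sum_any_scale[symmetric] W.scale_scale pw mult.assoc)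
  ultimately show ?thesis
    unfolding YW_Jacobi[OF assms] by (simp add: W.scale_right_diff_distrib)
qed

text \<open>
  The operator \<open>\<theta>(v)\<^sub>m\<close> on \<open>W\<close> whose transpose is the mode \<open>Y'(v)\<^sub>m\<close> of the contragredient module.
\<close>

definition adj :: "'v \<Rightarrow> int \<Rightarrow> 'w \<Rightarrow> 'w" where
  "adj v m w = Sum_any (\<lambda>k. YW (cvec v k) (- m - 2 - k) w)"

lemma finite_adj_support: "w \<in> W \<Longrightarrow> finite {k. YW (cvec v k) (f k) w \<noteq> 0}"
  by (rule finite_subset[OF _ finite_cvec[of v]]) (auto simp: YW_zero)

lemma adj_in: "w \<in> W \<Longrightarrow> adj v m w \<in> W"
  unfolding adj_def by (rule W.Sum_any_in_subspace[OF W_subspace]) (rule YW_in)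

lemma adj_add: "w \<in> W \<Longrightarrow> adj (x + y) m w = adj x m w + adj y m w"
  unfolding adj_def by (simp add: cvec_add YW_add Sum_any.distrib finite_adj_support)

lemma adj_add_right: "x \<in> W \<Longrightarrow> y \<in> W \<Longrightarrow> adj v m (x + y) = adj v m x + adj v m y"
  unfolding adj_def by (simp add: YW_add_right Sum_any.distrib finite_adj_support)

lemma adj_scale_right: "x \<in> W \<Longrightarrow> adj v m (sW c x) = sW c (adj v m x)"
  unfolding adj_def by (simp add: YW_scale_right W.Sum_any_scale)

lemma adj_additive: "w \<in> W \<Longrightarrow> additive_on UNIV (\<lambda>v. adj v m w)"
  and adj_additive_right: "additive_on W (adj v m)"
  by (simp_all add: additive_on_def adj_add adj_add_right)

lemma adj_zero: "w \<in> W \<Longrightarrow> adj 0 m w = 0"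
  by (rule additive_on_zero[OF adj_additive]) auto

lemma adj_zero_right: "adj v m 0 = 0"
  by (rule additive_on_zero[OF adj_additive_right]) auto

lemma adj_homog:
  assumes v: "v \<in> V.hom d" and w: "w \<in> W"
  shows "adj v m w = (\<Sum>i\<le>d. sW ((-1) ^ d / fact i) (YW ((L 1 ^^ i) v) (2 * int d - m - 2 - int i) w))"
proof -
  have "adj v m w = (\<Sum>i\<le>d. YW (sV ((-1) ^ d / fact i) ((L 1 ^^ i) v)) (- m - 2 - (int i - 2 * int d)) w)"
    unfolding adj_def by (rule Sum_any_cvec[OF v]) (rule YW_zero[OF w])
  also have "\<dots> = (\<Sum>i\<le>d. sW ((-1) ^ d / fact i) (YW ((L 1 ^^ i) v) (2 * int d - m - 2 - int i) w))"
  proof (rule sum.cong[OF refl])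
    fix i
    have e: "- m - 2 - (int i - 2 * int d) = 2 * int d - m - 2 - int i" by simp
    show "YW (sV ((-1) ^ d / fact i) ((L 1 ^^ i) v)) (- m - 2 - (int i - 2 * int d)) w =
        sW ((-1) ^ d / fact i) (YW ((L 1 ^^ i) v) (2 * int d - m - 2 - int i) w)"
      unfolding e by (rule YW_scale[OF w])
  qed
  finally show ?thesis .
qed

text \<open>
  The same formula with the degree of \<open>v\<close> an arbitrary integer and an arbitrary upper bound of the
  sum. It applies to \<open>u\<^sub>n\<^sub>+\<^sub>l v\<close>, whose degree may be negative, with a bound independent of \<open>l\<close>.
\<close>

lemma adj_weight:
  assumes v: "v \<in> V.weight d" and R: "d \<le> int R" and w: "w \<in> W"
  shows "adj v m w = (\<Sum>i\<le>R. sW ((-1) powi d / fact i) (YW ((L 1 ^^ i) v) (2 * d - m - 2 - int i) w))"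
proof (cases "d < 0")
  case True
  then have "v = 0" using V.weight_neg[OF v] by simp
  then show ?thesis using w by (simp add: adj_zero L1_pow_of_zero YW_zero)
next
  case False
  then obtain e where d: "d = int e" using nonneg_int_cases by (metis not_less)
  have "v \<in> V.hom e" using v by (simp add: d V.weight_of_nat)
  then have "adj v m w = (\<Sum>i\<le>e. sW ((-1) ^ e / fact i) (YW ((L 1 ^^ i) v) (2 * int e - m - 2 - int i) w))"
    using w by (rule adj_homog)
  also have "\<dots> = (\<Sum>i\<le>R. sW ((-1) ^ e / fact i) (YW ((L 1 ^^ i) v) (2 * int e - m - 2 - int i) w))"
  proof (rule sum.mono_neutral_left)
    show "\<forall>i\<in>{..R} - {..e}. sW ((-1) ^ e / fact i) (YW ((L 1 ^^ i) v) (2 * int e - m - 2 - int i) w) = 0"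
    proof
      fix i assume "i \<in> {..R} - {..e}"
      then have "d < int i" by (simp add: d)
      then have "(L 1 ^^ i) v = 0" by (rule L1_pow_zero[OF v])
      then show "sW ((-1) ^ e / fact i) (YW ((L 1 ^^ i) v) (2 * int e - m - 2 - int i) w) = 0"
        by (simp add: YW_zero w)
    qed
  qed (use R in \<open>simp_all add: d\<close>)
  finally show ?thesis by (simp add: d)
qed

lemma adj_scale:
  assumes w: "w \<in> W" shows "adj (sV c v) m w = sW c (adj v m w)"
proof -
  have "v \<in> UNIV" ..
  then show ?thesis
  proof (induction v rule: V.homogeneous_induct)
    case (homog d x)
    have "sV c x \<in> V.hom d" using homog by (rule subspace_scale[OF V.hom_subspace])
    then show ?case
      unfolding adj_homog[OF homog w] adj_homog[OF \<open>sV c x \<in> V.hom d\<close> w]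
      by (simp add: L1_pow_scale YW_scale w W.scale_sum_right mult.commute)
  next
    case (add x y)
    then show ?case by (simp add: scale_right_distrib W.scale_right_distrib adj_add w)
  qed
qed

end

section \<open>The opposite Jacobi identity\<close>

context weak_module
begin

lemma finite_YW_shift: "w \<in> W \<Longrightarrow> finite {l::nat. YW v (c + int l) w \<noteq> 0}"
proof -
  assume "w \<in> W"
  then obtain N where "\<forall>n\<ge>N. YW v n w = 0" using YW_truncation by blast
  then have "YW v (c + int l) w = 0" if "l \<ge> nat (N - c)" for l
    using that by simp
  then show ?thesis by (rule finite_nat_support)
qed

lemma adj_adj_homog:
  assumes u: "u \<in> V.hom d" and v: "v \<in> V.hom e" and w: "w \<in> W"
  shows "adj v q (adj u p w) = (\<Sum>i\<le>d. \<Sum>j\<le>e. sW ((-1) ^ (d + e) / (fact i * fact j))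
    (YW ((L 1 ^^ j) v) (2 * int e - q - 2 - int j) (YW ((L 1 ^^ i) u) (2 * int d - p - 2 - int i) w)))"
proof -
  have "adj v q (adj u p w) = (\<Sum>i\<le>d. adj v q (sW ((-1) ^ d / fact i) (YW ((L 1 ^^ i) u) (2 * int d - p - 2 - int i) w)))"
    unfolding adj_homog[OF u w]
    by (rule additive_on_sum[OF adj_additive_right]) (simp_all add: W_add W_scale YW_in w)
  also have "\<dots> = (\<Sum>i\<le>d. \<Sum>j\<le>e. sW ((-1) ^ (d + e) / (fact i * fact j))
    (YW ((L 1 ^^ j) v) (2 * int e - q - 2 - int j) (YW ((L 1 ^^ i) u) (2 * int d - p - 2 - int i) w)))"
    by (intro sum.cong refl) (simp add: adj_scale_right adj_homog[OF v] YW_in w W.scale_sum_right power_add)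
  finally show ?thesis .
qed

text \<open>
  Both sides are reduced to combinations of the vectors \<open>X i j t\<close> below, which stand for the mode of
  \<open>(L\<^sub>1\<^sup>i u)\<^sub>n\<^sub>+\<^sub>t L\<^sub>1\<^sup>j v\<close> divided by \<open>i! j!\<close>. On the right this uses the Jacobi identity of \<open>W\<close>, on the
  left the expansion of \<open>L\<^sub>1\<^sup>s (u\<^sub>n\<^sub>+\<^sub>l v)\<close>.
\<close>

lemma adj_Jacobi_homog:
  assumes u: "u \<in> V.hom d" and v: "v \<in> V.hom e" and w: "w \<in> W"
  shows "Sum_any (\<lambda>l::nat. sW (of_int m gchoose l) (adj (Y u (n + int l) v) (m + k - int l) w)) =
   Sum_any (\<lambda>l::nat. sW ((-1) ^ l * (of_int n gchoose l)) (adj v (k + int l) (adj u (m + n - int l) w))) -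
   Sum_any (\<lambda>l::nat. sW ((-1) powi (n + int l) * (of_int n gchoose l))
     (adj u (m + int l) (adj v (n + k - int l) w)))"
    (is "?L = ?R1 - ?R2")
proof -
  have uw: "u \<in> V.weight (int d)" and vw: "v \<in> V.weight (int e)"
    using u v by (simp_all add: V.weight_of_nat)
  define a where "a i = (L 1 ^^ i) u" for i
  define b where "b j = (L 1 ^^ j) v" for j
  \<comment> \<open>The exponents of the Jacobi identity of W that is applied to a i and b j.\<close>
  define M where "M i = 2 * int d - 2 - int i - m - n" for i
  define K where "K j = 2 * int e - 2 - int j - k - n" for j
  \<comment> \<open>The index of every mode that occurs, up to the shift by i + j + t.\<close>
  define P where "P = 2 * int d + 2 * int e - 4 - m - k - 2 * n"
  define sg :: complex where "sg = - ((-1) ^ (d + e) * (-1) powi n)"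
  \<comment> \<open>From t = N on, the vector Y (a i) (n + t) (b j) has negative degree.\<close>
  define N where "N = nat (int d + int e - n)"
  define X where "X i j t = sW (1 / (fact i * fact j)) (YW (Y (a i) (n + int t) (b j)) (P - int i - int j - int t) w)" for i j t
  define c :: "nat \<Rightarrow> nat \<Rightarrow> complex" where "c i j = (-1) ^ (d + e) / (fact i * fact j)" for i j
  define S1 where "S1 i j = Sum_any (\<lambda>l::nat. sW ((-1) ^ l * (of_int n gchoose l))
      (YW (b j) (n + K j - int l) (YW (a i) (M i + int l) w)))" for i j
  define S2 where "S2 i j = Sum_any (\<lambda>l::nat. sW ((-1) powi (n + int l) * (of_int n gchoose l))
      (YW (a i) (M i + n - int l) (YW (b j) (K j + int l) w)))" for i j
  have vanish: "Y (a i) (n + int t) (b j) = 0" if "t \<ge> N" for i j t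
    by (rule V.weight_neg[OF weight_mode[OF weight_L1_pow[OF uw, of i] weight_L1_pow[OF vw, of j], folded a_def b_def]])
      (use that in \<open>simp add: N_def\<close>)
  have X0: "X i j t = 0" if "i > d \<or> j > e \<or> t \<ge> N" for i j t
  proof -
    have "a i = 0" if "i > d" using L1_pow_zero[OF uw, of i] that by (simp add: a_def)
    moreover have "b j = 0" if "j > e" using L1_pow_zero[OF vw, of j] that by (simp add: b_def)
    ultimately have "Y (a i) (n + int t) (b j) = 0"
      using that vanish by (auto simp: Y_zero Y_zero_right)
    then show ?thesis by (simp add: X_def YW_zero w)
  qed
  have R1: "?R1 = (\<Sum>i\<le>d. \<Sum>j\<le>e. sW (c i j) (S1 i j))"
  proof -
    have "sW ((-1) ^ l * (of_int n gchoose l)) (adj v (k + int l) (adj u (m + n - int l) w)) =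
       (\<Sum>i\<le>d. \<Sum>j\<le>e. sW (c i j) (sW ((-1) ^ l * (of_int n gchoose l))
         (YW (b j) (n + K j - int l) (YW (a i) (M i + int l) w))))" for l
    proof -
      have "2 * int e - (k + int l) - 2 - int j = n + K j - int l"
        "2 * int d - (m + n - int l) - 2 - int i = M i + int l" for i j
        by (simp_all add: K_def M_def)
      then show ?thesis
        unfolding adj_adj_homog[OF u v w] W.scale_sum_right
        by (simp only: W.scale_scale mult.commute a_def[symmetric] b_def[symmetric] c_def[symmetric])
    qed
    then have "?R1 = Sum_any (\<lambda>l. \<Sum>i\<le>d. \<Sum>j\<le>e. sW (c i j) (sW ((-1) ^ l * (of_int n gchoose l))
         (YW (b j) (n + K j - int l) (YW (a i) (M i + int l) w))))" by simp
    also have "\<dots> = (\<Sum>i\<le>d. \<Sum>j\<le>e. Sum_any (\<lambda>l. sW (c i j) (sW ((-1) ^ l * (of_int n gchoose l))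
         (YW (b j) (n + K j - int l) (YW (a i) (M i + int l) w)))))"
    proof (rule Sum_any_sum_swap2)
      fix i j
      have "finite {l. YW (b j) (n + K j - int l) (YW (a i) (M i + int l) w) \<noteq> 0}"
        by (rule finite_subset[OF _ finite_YW_shift[OF w, of "a i" "M i"]]) (auto simp: YW_zero_right)
      then show "finite {l. sW (c i j) (sW ((-1) ^ l * (of_int n gchoose l))
         (YW (b j) (n + K j - int l) (YW (a i) (M i + int l) w))) \<noteq> 0}"
        by (intro W.finite_support_scale)
    qed
    finally show ?thesis unfolding S1_def W.Sum_any_scale .
  qed
  have R2: "?R2 = (\<Sum>i\<le>d. \<Sum>j\<le>e. sW (c i j) (S2 i j))"
  proof -
    have "sW ((-1) powi (n + int l) * (of_int n gchoose l)) (adj u (m + int l) (adj v (n + k - int l) w)) =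
       (\<Sum>j\<le>e. \<Sum>i\<le>d. sW (c i j) (sW ((-1) powi (n + int l) * (of_int n gchoose l))
         (YW (a i) (M i + n - int l) (YW (b j) (K j + int l) w))))" for l
    proof -
      have "2 * int e - (n + k - int l) - 2 - int j = K j + int l"
        "2 * int d - (m + int l) - 2 - int i = M i + n - int l"
        "(-1) ^ (e + d) / (fact j * fact i) = c i j" for i j
        by (simp_all add: K_def M_def c_def add.commute mult.commute)
      then show ?thesis
        unfolding adj_adj_homog[OF v u w] W.scale_sum_right
        by (simp only: W.scale_scale mult.commute a_def[symmetric] b_def[symmetric])
    qed
    then have "?R2 = Sum_any (\<lambda>l. \<Sum>j\<le>e. \<Sum>i\<le>d. sW (c i j) (sW ((-1) powi (n + int l) * (of_int n gchoose l))
         (YW (a i) (M i + n - int l) (YW (b j) (K j + int l) w))))" by simp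
    also have "\<dots> = (\<Sum>j\<le>e. \<Sum>i\<le>d. Sum_any (\<lambda>l. sW (c i j) (sW ((-1) powi (n + int l) * (of_int n gchoose l))
         (YW (a i) (M i + n - int l) (YW (b j) (K j + int l) w)))))"
    proof (rule Sum_any_sum_swap2)
      fix i j
      have "finite {l. YW (a i) (M i + n - int l) (YW (b j) (K j + int l) w) \<noteq> 0}"
        by (rule finite_subset[OF _ finite_YW_shift[OF w, of "b j" "K j"]]) (auto simp: YW_zero_right)
      then show "finite {l. sW (c i j) (sW ((-1) powi (n + int l) * (of_int n gchoose l))
         (YW (a i) (M i + n - int l) (YW (b j) (K j + int l) w))) \<noteq> 0}"
        by (intro W.finite_support_scale)
    qed
    finally show ?thesis unfolding S2_def W.Sum_any_scale by (subst sum.swap)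
  qed
  have MK: "M i + K j - int l = P - int i - int j - int l" for i j l
    by (simp add: M_def K_def P_def)
  have term_R: "sW (c i j) (S1 i j) - sW (c i j) (S2 i j) = (\<Sum>t<N. sW (sg * (of_int (M i) gchoose t)) (X i j t))" for i j
  proof -
    have "S1 i j - S2 i j = sW (- ((-1) powi n))
        (Sum_any (\<lambda>l. sW (of_int (M i) gchoose l) (YW (Y (a i) (n + int l) (b j)) (M i + K j - int l) w)))"
      unfolding S1_def S2_def by (rule YW_Jacobi_reversed[OF w])
    also have "Sum_any (\<lambda>l. sW (of_int (M i) gchoose l) (YW (Y (a i) (n + int l) (b j)) (M i + K j - int l) w)) =
        (\<Sum>l<N. sW (of_int (M i) gchoose l) (YW (Y (a i) (n + int l) (b j)) (P - int i - int j - int l) w))"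
      unfolding MK by (rule Sum_any_eq_sum_lessThan) (simp add: vanish YW_zero w)
    finally have "sW (c i j) (S1 i j) - sW (c i j) (S2 i j) = sW (c i j) (sW (- ((-1) powi n))
        (\<Sum>l<N. sW (of_int (M i) gchoose l) (YW (Y (a i) (n + int l) (b j)) (P - int i - int j - int l) w)))"
      by (simp only: W.scale_right_diff_distrib[symmetric])
    also have "\<dots> = (\<Sum>t<N. sW (sg * (of_int (M i) gchoose t)) (X i j t))"
      unfolding W.scale_sum_right W.scale_scale X_def
      by (rule sum.cong[OF refl]) (simp add: c_def sg_def mult_ac)
    finally show ?thesis .
  qed
  have R: "?R1 - ?R2 = (\<Sum>i\<le>d. \<Sum>j\<le>e. \<Sum>t<N. sW (sg * (of_int (M i) gchoose t)) (X i j t))"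
    unfolding R1 R2 sum_subtractf[symmetric] term_R ..
  define A where "A i = of_int (2 * int d - n - 2) - (of_nat i :: complex)" for i :: nat
  define g where "g i l q = sg * ((-1) ^ l * (of_int m gchoose l) * ((A i - of_nat l) gchoose q))" for i l q :: nat
  have L_term: "sW (of_int m gchoose l) (adj (Y u (n + int l) v) (m + k - int l) w) =
      (\<Sum>i\<le>d. \<Sum>j\<le>e. \<Sum>q<N - l. sW (g i l q) (X i j (l + q)))" if "l < N" for l
  proof -
    define D where "D = int d + int e - (n + int l) - 1"
    \<comment> \<open>Large enough to bound the degree D and to cover all triples with a nonzero term.\<close>
    define R where "R = d + e + N"
    have wt: "Y u (n + int l) v \<in> V.weight D" unfolding D_def by (rule weight_mode[OF uw vw])
    have DR: "D \<le> int R" by (simp add: D_def R_def N_def)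
    have sgD: "(-1) powi D = sg * (-1) ^ l"
      unfolding D_def sg_def minus_one_powi minus_one_power_iff by auto
    have inner: "sW ((of_int m gchoose l) * ((-1) powi D / fact s)) (YW ((L 1 ^^ s) (Y u (n + int l) v)) (2 * D - (m + k - int l) - 2 - int s) w) =
       (\<Sum>(i, j, q)\<in>triples s. sW (g i l q) (X i j (l + q)))" for s
    proof -
      define h where "h i j q = 1 / (fact i * fact j) * (((of_int (2 * int d - (n + int l) - 2) - of_nat i) :: complex) gchoose q)" for i j q :: nat
      have "sW ((of_int m gchoose l) * ((-1) powi D / fact s)) (YW ((L 1 ^^ s) (Y u (n + int l) v)) (2 * D - (m + k - int l) - 2 - int s) w) =
        sW ((of_int m gchoose l) * (-1) powi D) (YW (sV (1 / fact s) ((L 1 ^^ s) (Y u (n + int l) v))) (2 * D - (m + k - int l) - 2 - int s) w)"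
        by (simp add: YW_scale w)
      also have "YW (sV (1 / fact s) ((L 1 ^^ s) (Y u (n + int l) v))) (2 * D - (m + k - int l) - 2 - int s) w =
        (\<Sum>x\<in>triples s. YW (case x of (i, j, q) \<Rightarrow> sV (h i j q) (Y (a i) (n + int l + int q) (b j))) (2 * D - (m + k - int l) - 2 - int s) w)"
        unfolding L1_pow_mode[OF uw] a_def[symmetric] b_def[symmetric] h_def[symmetric]
        by (rule additive_on_sum[OF YW_additive[OF w]]) auto
      also have "sW ((of_int m gchoose l) * (-1) powi D) \<dots> = (\<Sum>(i, j, q)\<in>triples s. sW (g i l q) (X i j (l + q)))"
        unfolding W.scale_sum_right
      proof (intro sum.cong refl, clarify)
        fix i j q assume "(i, j, q) \<in> triples s"
        then have s: "int s = int i + int j + int q" by (auto simp: triples_def)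
        have e1: "2 * D - (m + k - int l) - 2 - int s = P - int i - int j - int (l + q)"
          unfolding s D_def P_def by simp
        have e2: "n + int l + int q = n + int (l + q)" by simp
        have e3: "of_int (2 * int d - (n + int l) - 2) - of_nat i = A i - of_nat l"
          by (simp add: A_def)
        show "sW ((of_int m gchoose l) * (-1) powi D) (YW (sV (h i j q) (Y (a i) (n + int l + int q) (b j))) (2 * D - (m + k - int l) - 2 - int s) w) =
            sW (g i l q) (X i j (l + q))"
          unfolding h_def e1 e2 e3 X_def g_def sgD by (simp add: YW_scale w mult_ac)
      qed
      finally show ?thesis .
    qed
    have "sW (of_int m gchoose l) (adj (Y u (n + int l) v) (m + k - int l) w) =
        (\<Sum>s\<le>R. \<Sum>(i, j, q)\<in>triples s. sW (g i l q) (X i j (l + q)))"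
      unfolding adj_weight[OF wt DR w] W.scale_sum_right W.scale_scale inner ..
    also have "\<dots> = (\<Sum>i\<le>d. \<Sum>j\<le>e. \<Sum>q<N - l. sW (g i l q) (X i j (l + q)))"
    proof (rule sum_triples_atMost)
      fix i j q assume "i > d \<or> j > e \<or> q \<ge> N - l"
      then have "X i j (l + q) = 0" by (intro X0) auto
      then show "sW (g i l q) (X i j (l + q)) = 0" by simp
    qed (simp add: R_def)
    finally show ?thesis .
  qed
  have "?L = (\<Sum>l<N. sW (of_int m gchoose l) (adj (Y u (n + int l) v) (m + k - int l) w))"
    by (rule Sum_any_eq_sum_lessThan) (use vanish[of _ 0 0] in \<open>simp add: a_def b_def adj_zero w\<close>)
  also have "\<dots> = (\<Sum>l<N. \<Sum>i\<le>d. \<Sum>j\<le>e. \<Sum>q<N - l. sW (g i l q) (X i j (l + q)))"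
    by (rule sum.cong[OF refl]) (simp add: L_term)
  also have "\<dots> = (\<Sum>i\<le>d. \<Sum>l<N. \<Sum>j\<le>e. \<Sum>q<N - l. sW (g i l q) (X i j (l + q)))"
    by (rule sum.swap)
  also have "\<dots> = (\<Sum>i\<le>d. \<Sum>j\<le>e. \<Sum>l<N. \<Sum>q<N - l. sW (g i l q) (X i j (l + q)))"
    by (rule sum.cong[OF refl], rule sum.swap)
  \<comment> \<open>Collect the terms with the same t = l + q.\<close>
  also have "\<dots> = (\<Sum>i\<le>d. \<Sum>j\<le>e. \<Sum>t<N. \<Sum>l\<le>t. sW (g i l (t - l)) (X i j (l + (t - l))))"
    unfolding sum_triangle ..
  also have "\<dots> = (\<Sum>i\<le>d. \<Sum>j\<le>e. \<Sum>t<N. sW (sg * (of_int (M i) gchoose t)) (X i j t))"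
  proof (intro sum.cong refl)
    fix i j t
    have "(\<Sum>l\<le>t. sW (g i l (t - l)) (X i j (l + (t - l)))) = sW (\<Sum>l\<le>t. g i l (t - l)) (X i j t)"
      unfolding W.scale_sum_left by (intro sum.cong refl) simp
    also have "(\<Sum>l\<le>t. g i l (t - l)) = sg * ((A i - of_int m) gchoose t)"
      unfolding g_def sum_distrib_left[symmetric] alternating_Vandermonde ..
    also have "A i - of_int m = of_int (M i)" by (simp add: A_def M_def)
    finally show "(\<Sum>l\<le>t. sW (g i l (t - l)) (X i j (l + (t - l)))) = sW (sg * (of_int (M i) gchoose t)) (X i j t)" .
  qed
  finally show ?thesis unfolding R .
qed

text \<open>
  The adjoint modes are truncated from below, since their formula contains the index with the
  opposite sign.
\<close>

lemma finite_adj_shift: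
  assumes w: "w \<in> W" shows "finite {l::nat. adj v (c - int l) w \<noteq> 0}"
proof -
  have "v \<in> UNIV" ..
  then show ?thesis
  proof (induction v rule: V.homogeneous_induct)
    case (homog d v)
    define g where "g i l = YW ((L 1 ^^ i) v) (2 * int d - c - 2 - int i + int l) w" for i l
    have adj_g: "adj v (c - int l) w = (\<Sum>i\<le>d. sW ((-1) ^ d / fact i) (g i l))" for l
    proof -
      have "2 * int d - (c - int l) - 2 - int i = 2 * int d - c - 2 - int i + int l" for i by simp
      then show ?thesis unfolding adj_homog[OF homog w] g_def by (simp only:)
    qed
    have "finite {l. g i l \<noteq> 0}" for i
      unfolding g_def by (rule finite_YW_shift[OF w])
    then have "finite (\<Union>i\<in>{..d}. {l. g i l \<noteq> 0})" by simp
    moreover have "adj v (c - int l) w = 0" if "l \<notin> (\<Union>i\<in>{..d}. {l. g i l \<noteq> 0})" for l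
    proof -
      have "g i l = 0" if "i \<le> d" for i using \<open>l \<notin> _\<close> that by simp
      then show ?thesis by (simp add: adj_g)
    qed
    then have "{l. adj v (c - int l) w \<noteq> 0} \<subseteq> (\<Union>i\<in>{..d}. {l. g i l \<noteq> 0})" by blast
    ultimately show ?case by (rule finite_subset[rotated])
  next
    case (add x y)
    then have "finite ({l::nat. adj x (c - int l) w \<noteq> 0} \<union> {l. adj y (c - int l) w \<noteq> 0})" by simp
    then show ?case by (rule finite_subset[rotated]) (auto simp: adj_add w)
  qed
qed

lemma finite_adj_Jacobi:
  assumes w: "w \<in> W"
  shows "finite {l::nat. adj (Y u (n + int l) v) (m + k - int l) w \<noteq> 0}"
    and "finite {l::nat. adj v (k + int l) (adj u (m - int l) w) \<noteq> 0}"
proof -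
  show "finite {l::nat. adj (Y u (n + int l) v) (m + k - int l) w \<noteq> 0}"
    by (rule finite_subset[OF _ finite_support_Y[of u n v]]) (auto simp: adj_zero w)
  show "finite {l::nat. adj v (k + int l) (adj u (m - int l) w) \<noteq> 0}"
    by (rule finite_subset[OF _ finite_adj_shift[OF w, of u m]]) (auto simp: adj_zero_right)
qed

text \<open>
  The reduction to homogeneous \<open>u\<close> and \<open>v\<close>. All three families of terms are biadditive in
  \<open>u\<close> and \<open>v\<close> and have finite support, so their sums are biadditive, too.
\<close>

lemma adj_Jacobi:
  assumes w: "w \<in> W"
  shows "Sum_any (\<lambda>l::nat. sW (of_int m gchoose l) (adj (Y u (n + int l) v) (m + k - int l) w)) =
   Sum_any (\<lambda>l::nat. sW ((-1) ^ l * (of_int n gchoose l)) (adj v (k + int l) (adj u (m + n - int l) w))) -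
   Sum_any (\<lambda>l::nat. sW ((-1) powi (n + int l) * (of_int n gchoose l))
     (adj u (m + int l) (adj v (n + k - int l) w)))"
proof -
  define A where "A u v l = sW (of_int m gchoose l) (adj (Y u (n + int l) v) (m + k - int l) w)" for u v and l :: nat
  define B where "B u v l = sW ((-1) ^ l * (of_int n gchoose l)) (adj v (k + int l) (adj u (m + n - int l) w))"
    for u v and l :: nat
  define C where "C u v l = sW ((-1) powi (n + int l) * (of_int n gchoose l)) (adj u (m + int l) (adj v (n + k - int l) w))"
    for u v and l :: nat
  have fin: "finite {l. A u v l \<noteq> 0}" "finite {l. B u v l \<noteq> 0}" "finite {l. C u v l \<noteq> 0}" for u v
    unfolding A_def B_def C_def by (intro W.finite_support_scale finite_adj_Jacobi[OF w])+
  have left: "A (x + y) v = (\<lambda>l. A x v l + A y v l)" "B (x + y) v = (\<lambda>l. B x v l + B y v l)"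
    "C (x + y) v = (\<lambda>l. C x v l + C y v l)" for x y v
    by (simp_all add: A_def B_def C_def Y_add adj_add adj_add_right adj_in w W.scale_right_distrib fun_eq_iff)
  have right: "A u (x + y) = (\<lambda>l. A u x l + A u y l)" "B u (x + y) = (\<lambda>l. B u x l + B u y l)"
    "C u (x + y) = (\<lambda>l. C u x l + C u y l)" for u x y
    by (simp_all add: A_def B_def C_def Y_add_right adj_add adj_add_right adj_in w W.scale_right_distrib fun_eq_iff)
  have "u \<in> UNIV" "v \<in> UNIV" by auto
  from this(1) have "Sum_any (A u v) = Sum_any (B u v) - Sum_any (C u v)"
  proof (induction u rule: V.homogeneous_induct)
    case (homog d u)
    note u = homog
    show ?case using \<open>v \<in> UNIV\<close>
    proof (induction v rule: V.homogeneous_induct)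
      case (homog e v)
      show ?case unfolding A_def B_def C_def by (rule adj_Jacobi_homog[OF u homog w])
    next
      case (add x y)
      then show ?case unfolding right by (simp only: Sum_any.distrib fin) simp
    qed
  next
    case (add x y)
    then show ?case unfolding left by (simp only: Sum_any.distrib fin) simp
  qed
  then show ?thesis unfolding A_def B_def C_def .
qed

lemma adj_vac:
  assumes "w \<in> W" shows "adj vac n w = (if n = -1 then w else 0)"
  using adj_homog[OF vac_degree assms, of n] YW_vac[OF assms] by simp

end

section \<open>Adjoint modes are involutive\<close>

context weak_module
begin

text \<open>
  For \<open>v\<close> of degree \<open>d\<close>, applying the formula for the adjoint modes twice gives the modes
  \<open>(L\<^sub>1\<^sup>t v)\<^sub>n\<^sub>-\<^sub>t\<close> with coefficient the sum of \<open>(-1)\<^sup>s / (s! (t - s)!)\<close> over \<open>s \<le> t\<close>, which is 0 unless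
  \<open>t = 0\<close>.
\<close>

lemma adj_involution:
  assumes w: "w \<in> W"
  shows "Sum_any (\<lambda>k. adj (cvec v k) (- n - 2 - k) w) = YW v n w"
proof -
  have "v \<in> UNIV" ..
  then show ?thesis
  proof (induction v rule: V.homogeneous_induct)
    case (homog d v)
    have vw: "v \<in> V.weight (int d)" using homog by (simp add: V.weight_of_nat)
    define Z where "Z r = YW ((L 1 ^^ r) v) (n - int r) w" for r
    have Z0: "Z r = 0" if "r > d" for r
      using L1_pow_zero[OF vw, of r] that by (simp add: Z_def YW_zero w)
    have "Sum_any (\<lambda>k. adj (cvec v k) (- n - 2 - k) w) =
      (\<Sum>s\<le>d. adj (sV ((-1) ^ d / fact s) ((L 1 ^^ s) v)) (- n - 2 - (int s - 2 * int d)) w)"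
      by (rule Sum_any_cvec[OF homog]) (rule adj_zero[OF w])
    also have "\<dots> = (\<Sum>s<Suc d. \<Sum>i<Suc d - s. sW ((-1) ^ s / (fact s * fact i)) (Z (s + i)))"
      unfolding lessThan_Suc_atMost
    proof (rule sum.cong[OF refl])
      fix s assume s: "s \<in> {..d}"
      define q where "q = - n - 2 - (int s - 2 * int d)"
      have "adj (sV ((-1) ^ d / fact s) ((L 1 ^^ s) v)) q w =
        sW ((-1) ^ d / fact s) (adj ((L 1 ^^ s) v) q w)"
        by (rule adj_scale[OF w])
      also have "adj ((L 1 ^^ s) v) q w = (\<Sum>i\<le>d. sW ((-1) powi (int d - int s) / fact i)
          (YW ((L 1 ^^ i) ((L 1 ^^ s) v)) (2 * (int d - int s) - q - 2 - int i) w))"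
        by (rule adj_weight[OF weight_L1_pow[OF vw] _ w]) simp
      also have "\<dots> = (\<Sum>i\<le>d. sW ((-1) powi (int d - int s) / fact i) (Z (s + i)))"
      proof (rule sum.cong[OF refl])
        fix i
        have "2 * (int d - int s) - q - 2 - int i = n - int (s + i)" by (simp add: q_def)
        moreover have "(L 1 ^^ i) ((L 1 ^^ s) v) = (L 1 ^^ (s + i)) v"
          by (simp add: add.commute[of s] funpow_add)
        ultimately show "sW ((-1) powi (int d - int s) / fact i)
          (YW ((L 1 ^^ i) ((L 1 ^^ s) v)) (2 * (int d - int s) - q - 2 - int i) w) =
          sW ((-1) powi (int d - int s) / fact i) (Z (s + i))"
          unfolding Z_def by (simp only:)
      qed
      also have "\<dots> = (\<Sum>i<Suc d - s. sW ((-1) powi (int d - int s) / fact i) (Z (s + i)))"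
      proof (rule sum.mono_neutral_right)
        have "Z (s + i) = 0" if "i \<notin> {..<Suc d - s}" for i
        proof (rule Z0)
          show "d < s + i" using that unfolding lessThan_iff by linarith
        qed
        then show "\<forall>i\<in>{..d} - {..<Suc d - s}. sW ((-1) powi (int d - int s) / fact i) (Z (s + i)) = 0"
          by simp
      qed auto
      also have "sW ((-1) ^ d / fact s) \<dots> = (\<Sum>i<Suc d - s. sW ((-1) ^ s / (fact s * fact i)) (Z (s + i)))"
      proof -
        have sg: "(-1) ^ d * (-1) powi (int d - int s) = ((-1) ^ s :: complex)"
          by (auto simp: minus_one_powi minus_one_power_iff)
        have "(-1) ^ d / fact s * ((-1) powi (int d - int s) / fact i) = (-1) ^ s / (fact s * fact i :: complex)" for i :: nat
          by (simp flip: sg)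
        then show ?thesis unfolding W.scale_sum_right W.scale_scale by simp
      qed
      finally show "adj (sV ((-1) ^ d / fact s) ((L 1 ^^ s) v)) (- n - 2 - (int s - 2 * int d)) w =
          (\<Sum>i<Suc d - s. sW ((-1) ^ s / (fact s * fact i)) (Z (s + i)))"
        unfolding q_def .
    qed
    also have "\<dots> = (\<Sum>t<Suc d. \<Sum>s\<le>t. sW ((-1) ^ s / (fact s * fact (t - s))) (Z (s + (t - s))))"
      by (rule sum_triangle)
    also have "\<dots> = (\<Sum>t<Suc d. sW (if t = 0 then 1 else 0) (Z t))"
    proof (rule sum.cong[OF refl])
      fix t
      have "(\<Sum>s\<le>t. sW ((-1) ^ s / (fact s * fact (t - s))) (Z (s + (t - s)))) =
        sW (\<Sum>s\<le>t. (-1) ^ s / (fact s * fact (t - s))) (Z t)"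
        unfolding W.scale_sum_left by (rule sum.cong[OF refl]) simp
      then show "(\<Sum>s\<le>t. sW ((-1) ^ s / (fact s * fact (t - s))) (Z (s + (t - s)))) =
        sW (if t = 0 then 1 else 0) (Z t)"
        unfolding sum_alternating_inverse_facts .
    qed
    also have "\<dots> = Z 0" by (simp add: sum.lessThan_Suc_shift del: sum.lessThan_Suc)
    finally show ?case by (simp add: Z_def)
  next
    case (add x y)
    have "finite {k. adj (cvec v k) (- n - 2 - k) w \<noteq> 0}" for v
      by (rule finite_subset[OF _ finite_cvec[of v]]) (auto simp: adj_zero w)
    then show ?case using add by (simp add: cvec_add adj_add w Sum_any.distrib YW_add)
  qed
qed

end

section \<open>The contragredient module\<close>

context admissible_module
begin

sublocale WG: graded_space sW W LW
  using W_subspace LW_grading by unfold_locales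

lemma LW_YW:
  assumes v: "v \<in> V.weight d" and w: "w \<in> W"
  shows "LW (YW v n w) = YW v n (LW w) + sW (of_int (d - n - 1)) (YW v n w)"
proof -
  have "LW (YW v n w) = YW v n (LW w) + (YW (L 0 v) n w - sW (of_int (n + 1)) (YW v n w))"
    using YW_grading[OF w, of v n] by (simp add: algebra_simps)
  also have "YW (L 0 v) n w = sW (of_int d) (YW v n w)"
    by (simp add: weightD[OF v] YW_scale w)
  finally show ?thesis by (simp only: W.scale_left_diff_distrib[symmetric]) (simp add: algebra_simps)
qed

text \<open>
  Each term of the formula for the adjoint mode shifts the degree by the same amount: the degree
  \<open>d - i\<close> of \<open>L\<^sub>1\<^sup>i v\<close> and the index \<open>2d - n - 2 - i\<close> give \<open>n + 1 - d\<close> for all \<open>i\<close>.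
\<close>

lemma LW_adj_homog:
  assumes v: "v \<in> V.hom d" and w: "w \<in> W"
  shows "LW (adj v n w) = adj v n (LW w) + sW (of_int (n + 1 - int d)) (adj v n w)"
proof -
  have vw: "v \<in> V.weight (int d)" using v by (simp add: V.weight_of_nat)
  define c :: "nat \<Rightarrow> complex" where "c i = (-1) ^ d / fact i" for i
  define X where "X i = YW ((L 1 ^^ i) v) (2 * int d - n - 2 - int i)" for i
  have X: "LW (X i w) = X i (LW w) + sW (of_int (n + 1 - int d)) (X i w)" for i
  proof -
    have "int d - int i - (2 * int d - n - 2 - int i) - 1 = n + 1 - int d" by simp
    then show ?thesis using LW_YW[OF weight_L1_pow[OF vw, of i] w, of "2 * int d - n - 2 - int i"]
      unfolding X_def by simp
  qed
  have Xin: "X i w \<in> W" for i unfolding X_def by (rule YW_in[OF w])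
  have "LW (adj v n w) = (\<Sum>i\<le>d. LW (sW (c i) (X i w)))"
    unfolding adj_homog[OF v w] c_def[symmetric] X_def[symmetric]
    by (rule additive_on_sum[OF WG.T_additive]) (auto intro: W_add W_scale Xin)
  also have "\<dots> = (\<Sum>i\<le>d. sW (c i) (X i (LW w))) + sW (of_int (n + 1 - int d)) (\<Sum>i\<le>d. sW (c i) (X i w))"
    by (simp add: WG.T_scale Xin X W.scale_right_distrib sum.distrib W.scale_sum_right mult.commute)
  finally show ?thesis
    unfolding adj_homog[OF v w] adj_homog[OF v WG.T_in[OF w]] c_def X_def .
qed

lemma adj_hom_weight:
  assumes "v \<in> V.hom d" "w \<in> WG.hom q"
  shows "adj v n w \<in> WG.weight (int q + n + 1 - int d)"
proof -
  have w: "w \<in> W" using assms(2) by (rule WG.hom_subset)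
  have "LW (adj v n w) = sW (of_nat q) (adj v n w) + sW (of_int (n + 1 - int d)) (adj v n w)"
    using LW_adj_homog[OF assms(1) w, of n] by (simp add: WG.hom_T[OF assms(2)] adj_scale_right w)
  then show ?thesis
    by (simp add: WG.weight_def adj_in w flip: W.scale_left_distrib)
qed

text \<open>
  Read through the pairing, this is the compatibility of \<open>Y'\<close> with the degree operator of the
  graded dual.
\<close>

lemma LW_adj:
  assumes w: "w \<in> W"
  shows "LW (adj v n w) - adj v n (LW w) = sW (of_int (n + 1)) (adj v n w) - adj (L 0 v) n w"
proof -
  have "v \<in> UNIV" ..
  then show ?thesis
  proof (induction v rule: V.homogeneous_induct)
    case (homog d v)
    have "adj (L 0 v) n w = sW (of_nat d) (adj v n w)"
      by (simp add: V.hom_T[OF homog] adj_scale w)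
    then show ?case
      using LW_adj_homog[OF homog w, of n] by (simp add: W.scale_left_diff_distrib W.scale_left_distrib)
  next
    case (add x y)
    have "LW (adj (x + y) n w) - adj (x + y) n (LW w) =
        (LW (adj x n w) - adj x n (LW w)) + (LW (adj y n w) - adj y n (LW w))"
      by (simp add: adj_add w WG.T_in WG.T_add adj_in)
    also have "\<dots> = sW (of_int (n + 1)) (adj (x + y) n w) - adj (L 0 (x + y)) n w"
      unfolding add by (simp add: adj_add w L_add W.scale_right_distrib)
    finally show ?case .
  qed
qed

abbreviation YD where "YD \<equiv> contragredient sV L W YW"

lemma YD_apply:
  assumes f: "f \<in> WG.dual" and w: "w \<in> W" shows "YD v n f w = f (adj v n w)"
proof -
  have "f (adj v n w) = Sum_any (\<lambda>k. f (YW (cvec v k) (- n - 2 - k) w))"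
    unfolding adj_def
    by (rule additive_on_Sum_any[OF WG.form_additive[OF WG.dual_form[OF f]]])
      (simp_all add: WG.add_in YW_in w finite_adj_support)
  then show ?thesis using w by (simp add: contragredient_def)
qed

lemma YD_outside: "w \<notin> W \<Longrightarrow> YD v n f w = 0"
  by (simp add: contragredient_def)

lemma dual_vanish_weight:
  assumes f: "f \<in> WG.dual" and N: "\<forall>m\<ge>N. \<forall>x\<in>WG.hom m. f x = 0"
    and y: "y \<in> WG.weight k" and k: "int N \<le> k"
  shows "f y = 0"
proof -
  have "y \<in> WG.hom (nat k)" using WG.weight_nonneg[OF y] k by simp
  moreover have "N \<le> nat k" using k by simp
  ultimately show ?thesis using N by blast
qed

lemma YD_form: "f \<in> WG.dual \<Longrightarrow> WG.form (YD v n f)"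
  by (simp add: WG.form_def additive_on_def YD_apply YD_outside WG.add_in WG.scale_in adj_in
      adj_add_right adj_scale_right WG.form_add[OF WG.dual_form] WG.form_scale[OF WG.dual_form])

text \<open>
  If \<open>v\<close> has degree \<open>d\<close>, then the adjoint mode raises the degree by \<open>n + 1 - d\<close>, so that the new
  form vanishes in large degrees because \<open>f\<close> does.
\<close>

lemma YD_in:
  assumes f: "f \<in> WG.dual" shows "YD v n f \<in> WG.dual"
proof -
  obtain N where N: "\<forall>m\<ge>N. \<forall>x\<in>WG.hom m. f x = 0" using WG.dual_bound[OF f] by blast
  have "v \<in> UNIV" ..
  then have "\<exists>K. \<forall>m\<ge>K. \<forall>x\<in>WG.hom m. f (adj v n x) = 0"
  proof (induction v rule: V.homogeneous_induct)
    case (homog d v)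
    have "f (adj v n x) = 0" if "m \<ge> nat (int N - n - 1 + int d)" "x \<in> WG.hom m" for m x
      by (rule dual_vanish_weight[OF f N adj_hom_weight[OF homog that(2), of n]]) (use that(1) in linarith)
    then show ?case by blast
  next
    case (add x y)
    obtain K where K: "\<forall>m\<ge>K. \<forall>z\<in>WG.hom m. f (adj x n z) = 0" using add by blast
    obtain J where J: "\<forall>m\<ge>J. \<forall>z\<in>WG.hom m. f (adj y n z) = 0" using add by blast
    have "f (adj (x + y) n z) = 0" if "m \<ge> max J K" "z \<in> WG.hom m" for m z
    proof -
      have "m \<ge> J" "m \<ge> K" using that(1) by simp_all
      then have "f (adj x n z) = 0" "f (adj y n z) = 0" using J K that(2) by blast+
      then show ?thesis
        using WG.hom_subset[OF that(2)] by (simp add: adj_add adj_in WG.form_add[OF WG.dual_form[OF f]])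
    qed
    then show ?case by blast
  qed
  then obtain K where K: "\<forall>m\<ge>K. \<forall>x\<in>WG.hom m. f (adj v n x) = 0" by blast
  show ?thesis
  proof (rule WG.dualI[OF YD_form[OF f]])
    fix m x assume "K \<le> m" and x: "x \<in> WG.hom m"
    then have "f (adj v n x) = 0" using K by blast
    then show "YD v n f x = 0" by (simp add: YD_apply[OF f] WG.hom_subset[OF x])
  qed
qed

text \<open>
  If \<open>v\<close> has degree \<open>d\<close> and \<open>f\<close> vanishes from degree \<open>N\<close> on, then for \<open>n \<ge> N + d\<close> the adjoint mode
  sends every homogeneous vector to a degree in which \<open>f\<close> vanishes.
\<close>

lemma YD_truncation:
  assumes f: "f \<in> WG.dual" shows "\<exists>K. \<forall>n\<ge>K. YD v n f = 0"
proof -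
  obtain N where N: "\<forall>m\<ge>N. \<forall>x\<in>WG.hom m. f x = 0" using WG.dual_bound[OF f] by blast
  have "v \<in> UNIV" ..
  then show ?thesis
  proof (induction v rule: V.homogeneous_induct)
    case (homog d v)
    have "YD v n f = 0" if n: "n \<ge> int N + int d" for n
    proof (rule WG.form_ext[OF YD_form[OF f] WG.form_zero_fun])
      fix m x assume x: "x \<in> WG.hom m"
      have "f (adj v n x) = 0"
        by (rule dual_vanish_weight[OF f N adj_hom_weight[OF homog x, of n]]) (use n in linarith)
      then show "YD v n f x = 0 x" by (simp add: YD_apply[OF f] WG.hom_subset[OF x])
    qed
    then show ?case by blast
  next
    case (add x y)
    obtain K where K: "\<forall>n\<ge>K. YD x n f = 0" using add by blast
    obtain J where J: "\<forall>n\<ge>J. YD y n f = 0" using add by blast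
    have "YD (x + y) n f = 0" if "n \<ge> max J K" for n
    proof
      fix w
      have "YD x n f w = 0" "YD y n f w = 0" using J K that by simp_all
      then show "YD (x + y) n f w = 0 w"
        by (cases "w \<in> W")
          (simp_all add: YD_apply[OF f] YD_outside adj_add adj_in WG.form_add[OF WG.dual_form[OF f]])
    qed
    then show ?case by blast
  qed
qed

lemma YD_add: "f \<in> WG.dual \<Longrightarrow> YD (u + v) n f = YD u n f + YD v n f"
proof
  fix w assume f: "f \<in> WG.dual"
  show "YD (u + v) n f w = (YD u n f + YD v n f) w"
    by (cases "w \<in> W") (simp_all add: YD_apply[OF f] YD_outside adj_add adj_in WG.form_add[OF WG.dual_form[OF f]])
qed

lemma YD_scale: "f \<in> WG.dual \<Longrightarrow> YD (sV a v) n f = scale_fun a (YD v n f)"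
proof
  fix w assume f: "f \<in> WG.dual"
  show "YD (sV a v) n f w = scale_fun a (YD v n f) w"
    unfolding scale_fun_def
    by (cases "w \<in> W") (simp_all add: YD_apply[OF f] YD_outside adj_scale adj_in WG.form_scale[OF WG.dual_form[OF f]])
qed

lemma YD_zero: "f \<in> WG.dual \<Longrightarrow> YD 0 n f = 0"
  by (rule additive_on_zero[where W = UNIV and h = "\<lambda>v. YD v n f"]) (simp_all add: additive_on_def YD_add)

lemma YD_zero_right: "YD v n 0 = 0"
  by (rule ext) (simp add: contragredient_def)

lemma finite_YD_shift:
  assumes "f \<in> WG.dual" shows "finite {l::nat. YD v (c + int l) f \<noteq> 0}"
proof -
  obtain K where "\<forall>n\<ge>K. YD v n f = 0" using YD_truncation[OF assms] by blast
  then have "YD v (c + int l) f = 0" if "l \<ge> nat (K - c)" for l using that by simp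
  then show ?thesis by (rule finite_nat_support)
qed

text \<open>
  Both a sum of forms and the sum of the vectors at which \<open>f\<close> is evaluated must be finite for the
  pairing to commute with the sums; the two conditions are independent of each other.
\<close>

lemma dual_Sum_any_apply:
  assumes f: "f \<in> WG.dual" and fin: "finite {l. g l \<noteq> 0}" "finite {l. h l \<noteq> 0}"
    and h: "\<And>l. h l \<in> W" and gh: "\<And>l. g l w = f (h l)"
  shows "Sum_any (\<lambda>l. scale_fun (c l) (g l)) w = f (Sum_any (\<lambda>l. sW (c l) (h l)))"
proof -
  interpret F: vector_space scale_fun by (rule vector_space_scale_fun)
  have "Sum_any (\<lambda>l. scale_fun (c l) (g l)) w = Sum_any (\<lambda>l. scale_fun (c l) (g l) w)"
    by (rule Sum_any_apply) (rule F.finite_support_scale[OF fin(1)])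
  also have "\<dots> = Sum_any (\<lambda>l. f (sW (c l) (h l)))"
    by (simp add: scale_fun_def gh WG.form_scale[OF WG.dual_form[OF f]] h)
  also have "\<dots> = f (Sum_any (\<lambda>l. sW (c l) (h l)))"
    by (rule additive_on_Sum_any[OF WG.form_additive[OF WG.dual_form[OF f]], symmetric])
      (simp_all only: WG.zero_in WG.add_in WG.scale_in h W.finite_support_scale[OF fin(2)])
  finally show ?thesis .
qed

text \<open>
  Evaluated at a vector of \<open>W\<close>, this is the opposite Jacobi identity of the adjoint modes with \<open>f\<close>
  applied to it.
\<close>

lemma YD_Jacobi: "jacobi_identity Y scale_fun WG.dual YD"
  unfolding jacobi_identity_def
proof (intro allI ballI)
  fix u v m n k f assume f: "f \<in> WG.dual"
  interpret F: vector_space scale_fun by (rule vector_space_scale_fun)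
  define A where "A l = YD (Y u (n + int l) v) (m + k - int l) f" for l :: nat
  define B where "B l = YD u (m + n - int l) (YD v (k + int l) f)" for l :: nat
  define C where "C l = YD v (n + k - int l) (YD u (m + int l) f)" for l :: nat
  have A: "finite {l. A l \<noteq> 0}"
    by (rule finite_subset[OF _ finite_support_Y[of u n v]]) (auto simp: A_def YD_zero[OF f])
  have B: "finite {l. B l \<noteq> 0}"
    by (rule finite_subset[OF _ finite_YD_shift[OF f, of v k]]) (auto simp: B_def YD_zero_right)
  have C: "finite {l. C l \<noteq> 0}"
    by (rule finite_subset[OF _ finite_YD_shift[OF f, of u m]]) (auto simp: C_def YD_zero_right)
  have "Sum_any (\<lambda>l. scale_fun (of_int m gchoose l) (A l)) w =
      Sum_any (\<lambda>l. scale_fun ((-1) ^ l * (of_int n gchoose l)) (B l)) w -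
      Sum_any (\<lambda>l. scale_fun ((-1) powi (n + int l) * (of_int n gchoose l)) (C l)) w" for w
  proof (cases "w \<in> W")
    case True
    have "Sum_any (\<lambda>l. scale_fun (of_int m gchoose l) (A l)) w =
        f (Sum_any (\<lambda>l::nat. sW (of_int m gchoose l) (adj (Y u (n + int l) v) (m + k - int l) w)))"
      by (rule dual_Sum_any_apply[OF f A finite_adj_Jacobi(1)[OF True] adj_in[OF True]])
        (simp add: A_def YD_apply f True)
    moreover have "Sum_any (\<lambda>l. scale_fun ((-1) ^ l * (of_int n gchoose l)) (B l)) w =
        f (Sum_any (\<lambda>l::nat. sW ((-1) ^ l * (of_int n gchoose l)) (adj v (k + int l) (adj u (m + n - int l) w))))"
      by (rule dual_Sum_any_apply[OF f B finite_adj_Jacobi(2)[OF True] adj_in[OF adj_in[OF True]]])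
        (simp add: B_def YD_apply YD_in adj_in f True)
    moreover have "Sum_any (\<lambda>l. scale_fun ((-1) powi (n + int l) * (of_int n gchoose l)) (C l)) w =
        f (Sum_any (\<lambda>l::nat. sW ((-1) powi (n + int l) * (of_int n gchoose l)) (adj u (m + int l) (adj v (n + k - int l) w))))"
      by (rule dual_Sum_any_apply[OF f C finite_adj_Jacobi(2)[OF True] adj_in[OF adj_in[OF True]]])
        (simp add: C_def YD_apply YD_in adj_in f True)
    moreover have "f (x - y) = f x - f y" if "x \<in> W" "y \<in> W" for x y
      using WG.form_add[OF WG.dual_form[OF f], of "x - y" y] W.subspace_diff[OF W_subspace that] that by simp
    moreover have "Sum_any (\<lambda>l. sW (c l) (adj u (p l) (adj v (q l) w))) \<in> W" for u v p q and c :: "nat \<Rightarrow> complex"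
      by (rule W.Sum_any_in_subspace[OF W_subspace]) (intro WG.scale_in adj_in True)
    ultimately show ?thesis unfolding adj_Jacobi[OF True] by simp
  next
    case False
    have zero: "Sum_any (\<lambda>l. scale_fun (c l) (g l)) w = 0"
      if "finite {l. g l \<noteq> 0}" "\<And>l. g l w = 0" for c :: "nat \<Rightarrow> complex" and g
    proof -
      have "Sum_any (\<lambda>l. scale_fun (c l) (g l)) w = Sum_any (\<lambda>l. scale_fun (c l) (g l) w)"
        by (rule Sum_any_apply) (rule F.finite_support_scale[OF that(1)])
      then show ?thesis by (simp add: that(2) scale_fun_apply)
    qed
    have "A l w = 0" "B l w = 0" "C l w = 0" for l
      using False by (simp_all add: A_def B_def C_def YD_outside)
    then show ?thesis by (simp only: zero A B C diff_self)
  qed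
  then show "Sum_any (\<lambda>l. scale_fun (of_int m gchoose l) (YD (Y u (n + int l) v) (m + k - int l) f)) =
      Sum_any (\<lambda>l. scale_fun ((-1) ^ l * (of_int n gchoose l)) (YD u (m + n - int l) (YD v (k + int l) f))) -
      Sum_any (\<lambda>l. scale_fun ((-1) powi (n + int l) * (of_int n gchoose l)) (YD v (n + k - int l) (YD u (m + int l) f)))"
    unfolding A_def[symmetric] B_def[symmetric] C_def[symmetric] by (simp add: fun_eq_iff)
qed

lemma contragredient_endo: "endo_on scale_fun WG.dual (YD v n)"
  unfolding endo_on_def
proof (intro conjI ballI allI)
  fix f g assume f: "f \<in> WG.dual" and g: "g \<in> WG.dual"
  show "YD v n (f + g) = YD v n f + YD v n g"
  proof
    fix w show "YD v n (f + g) w = (YD v n f + YD v n g) w"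
      by (cases "w \<in> W") (simp_all add: YD_apply YD_outside WG.dual_plus f g)
  qed
next
  fix f a assume f: "f \<in> WG.dual"
  show "YD v n (scale_fun a f) = scale_fun a (YD v n f)"
  proof
    fix w show "YD v n (scale_fun a f) w = scale_fun a (YD v n f) w"
      by (cases "w \<in> W")
        (simp_all add: YD_apply WG.dual_scale f scale_fun_apply YD_outside)
  qed
qed (rule YD_in)

theorem admissible_contragredient:
  "admissible_module sV Y vac L conf scale_fun WG.dual YD WG.dualT"
proof (intro admissible_module.intro weak_module.intro weak_module_axioms.intro admissible_module_axioms.intro)
  show "voa sV Y vac L conf" by unfold_locales
  show "vector_space scale_fun" by (rule vector_space_scale_fun)
  show "module.subspace scale_fun WG.dual" by (rule WG.dual_subspace)
  show "endo_on scale_fun WG.dual (YD v n)" for v n by (rule contragredient_endo)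
  show "jacobi_identity Y scale_fun WG.dual YD" by (rule YD_Jacobi)
  show "grading_operator scale_fun WG.dual WG.dualT"
    using WG.dual_graded_space by (simp add: graded_space_def graded_space_axioms_def)
  fix f assume f: "f \<in> WG.dual"
  note form = WG.dual_form[OF f]
  show "YD (u + v) n f = YD u n f + YD v n f" for u v n by (rule YD_add[OF f])
  show "YD (sV a v) n f = scale_fun a (YD v n f)" for a v n by (rule YD_scale[OF f])
  show "\<exists>N. \<forall>n\<ge>N. YD v n f = 0" for v by (rule YD_truncation[OF f])
  show "YD vac n f = (if n = -1 then f else 0)" for n
  proof
    fix w show "YD vac n f w = (if n = -1 then f else 0) w"
      by (cases "w \<in> W")
        (simp_all add: YD_apply[OF f] YD_outside adj_vac WG.form_outside[OF form] WG.form_zero[OF form])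
  qed
  show "WG.dualT (YD v n f) - YD v n (WG.dualT f) = YD (L 0 v) n f - scale_fun (of_int (n + 1)) (YD v n f)" for v n
  proof
    fix w
    show "(WG.dualT (YD v n f) - YD v n (WG.dualT f)) w =
        (YD (L 0 v) n f - scale_fun (of_int (n + 1)) (YD v n f)) w"
    proof (cases "w \<in> W")
      case True
      have move: "a + d = b + c" if "a - b = c - d" for a b c d :: 'w
        using that by (simp add: algebra_simps)
      have "f (LW (adj v n w) + adj (L 0 v) n w) = f (adj v n (LW w) + sW (of_int (n + 1)) (adj v n w))"
        by (simp only: move[OF LW_adj[OF True]])
      then have "f (LW (adj v n w)) + f (adj (L 0 v) n w) = f (adj v n (LW w)) + of_int (n + 1) * f (adj v n w)"
        by (simp only: WG.form_add[OF form] WG.form_scale[OF form] adj_in WG.T_in WG.scale_in True)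
      then have "f (adj v n (LW w)) - f (LW (adj v n w)) =
          f (adj (L 0 v) n w) - of_int (n + 1) * f (adj v n w)"
        by (simp add: algebra_simps)
      then show ?thesis
        using True
        by (simp add: WG.dual_T_apply YD_in f YD_apply WG.dual_T_in adj_in WG.T_in)
          (simp add: scale_fun_def YD_apply f)
    next
      case False
      then show ?thesis by (simp add: WG.dual_T_outside YD_in f YD_outside) (simp add: scale_fun_def YD_outside)
    qed
  qed
qed

lemma double_contragredient:
  assumes w: "w \<in> W"
  shows "contragredient sV L WG.dual YD v n (WG.ev w) = WG.ev (YW v n w)"
proof
  fix f
  show "contragredient sV L WG.dual YD v n (WG.ev w) f = WG.ev (YW v n w) f"
  proof (cases "f \<in> WG.dual")
    case True
    have "f (YW v n w) = f (Sum_any (\<lambda>k. adj (cvec v k) (- n - 2 - k) w))"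
      by (simp only: adj_involution[OF w])
    also have "\<dots> = Sum_any (\<lambda>k. f (adj (cvec v k) (- n - 2 - k) w))"
    proof (rule additive_on_Sum_any[OF WG.form_additive[OF WG.dual_form[OF True]]])
      show "finite {k. adj (cvec v k) (- n - 2 - k) w \<noteq> 0}"
        by (rule finite_subset[OF _ finite_cvec[of v]]) (auto simp: adj_zero w)
    qed (simp_all add: WG.add_in adj_in w)
    finally show ?thesis
      using True by (simp add: contragredient_def[of _ _ WG.dual] WG.ev_apply YD_in YD_apply w)
  qed (simp add: contragredient_def eval_at_def)
qed

end

theorem theorem9p21:
  fixes sV :: "complex \<Rightarrow> 'v::ab_group_add \<Rightarrow> 'v"
    and Y :: "'v \<Rightarrow> int \<Rightarrow> 'v \<Rightarrow> 'v"
    and vac :: 'v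
    and L :: "int \<Rightarrow> 'v \<Rightarrow> 'v"
    and conf :: 'v
    and sW :: "complex \<Rightarrow> 'w::ab_group_add \<Rightarrow> 'w"
    and W :: "'w set"
    and YW :: "'v \<Rightarrow> int \<Rightarrow> 'w \<Rightarrow> 'w"
    and LW :: "'w \<Rightarrow> 'w"
  defines "W' \<equiv> graded_dual sW W LW"
    and "L' \<equiv> dual_L0 sW W LW"
    and "Y' \<equiv> contragredient sV L W YW"
  defines "W'' \<equiv> graded_dual scale_fun W' L'"
    and "L'' \<equiv> dual_L0 scale_fun W' L'"
    and "Y'' \<equiv> contragredient sV L W' Y'"
  assumes "voa sV Y vac L conf"
    and "admissible_module sV Y vac L conf sW W YW LW"
  shows "admissible_module sV Y vac L conf scale_fun W' Y' L' \<and>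
    (finitely_admissible_module sV Y vac L conf sW W YW LW \<longrightarrow>
       finitely_admissible_module sV Y vac L conf scale_fun W' Y' L' \<and>
       bij_betw (eval_at W') W W'' \<and>
       (\<forall>x\<in>W. \<forall>y\<in>W. eval_at W' (x + y) = eval_at W' x + eval_at W' y) \<and>
       (\<forall>a. \<forall>x\<in>W. eval_at W' (sW a x) = scale_fun a (eval_at W' x)) \<and>
       (\<forall>n. eval_at W' ` homog sW W LW n = homog scale_fun W'' L'' n) \<and>
       (\<forall>v n. \<forall>w\<in>W. Y'' v n (eval_at W' w) = eval_at W' (YW v n w)))"
proof (intro conjI impI)
  interpret M: admissible_module sV Y vac L conf sW W YW LW by fact
  show adm: "admissible_module sV Y vac L conf scale_fun W' Y' L'"
    unfolding W'_def Y'_def L'_def by (rule M.admissible_contragredient)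
  show "\<forall>x\<in>W. \<forall>y\<in>W. eval_at W' (x + y) = eval_at W' x + eval_at W' y"
    unfolding W'_def by (intro ballI M.WG.ev_add)
  show "\<forall>a. \<forall>x\<in>W. eval_at W' (sW a x) = scale_fun a (eval_at W' x)"
    unfolding W'_def by (intro allI ballI M.WG.ev_scale)
  show "\<forall>v n. \<forall>w\<in>W. Y'' v n (eval_at W' w) = eval_at W' (YW v n w)"
    unfolding Y''_def Y'_def W'_def by (intro allI ballI M.double_contragredient)
  assume "finitely_admissible_module sV Y vac L conf sW W YW LW"
  then interpret FM: finitely_admissible_module sV Y vac L conf sW W YW LW .
  interpret FG: finite_graded_space sW W LW by unfold_locales (rule FM.finite_dim)
  show "finitely_admissible_module sV Y vac L conf scale_fun W' Y' L'"
  proof (intro finitely_admissible_module.intro adm finitely_admissible_module_axioms.intro)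
    show "\<exists>B. finite B \<and> module.span scale_fun B = homog scale_fun W' L' n" for n
      unfolding W'_def L'_def M.WG.homog_dual by (rule FG.finite_dimensional_dhom)
  qed
  show "bij_betw (eval_at W') W W''"
    unfolding W''_def W'_def L'_def by (rule FG.ev_bij)
  show "\<forall>n. eval_at W' ` homog sW W LW n = homog scale_fun W'' L'' n"
    unfolding W''_def L''_def W'_def L'_def by (intro allI FG.ev_image_homog)
qed

end
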